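(* Let $S_1,\dots,S_n \subset \mathbb{Q}^n$ be finite sets and let $\tilde{S} = S_1 \cup \cdots \cup S_n$. If for every proper positive dimensional face $F$ of $\operatorname{conv}(\tilde{S})$ we have $F \cap S_i \neq \varnothing$ for each $i = 1,\dots,n$, then \[ \operatorname{MV}(\operatorname{conv} S_1,\dots,\operatorname{conv} S_n) = n!\,\operatorname{vol}_n(\operatorname{conv}(\tilde{S})). \]
   Context: For convex polytopes $Q_1,\dots,Q_n\subset\mathbb{R}^n$, the mixed volume $\operatorname{MV}(Q_1,\dots,Q_n)$ is the coefficient of $\lambda_1\cdots\lambda_n$ in the polynomial $\operatorname{vol}_n(\lambda_1Q_1+\cdots+\lambda_nQ_n)$ (Minkowski sum, $\lambda_i>0$), where $\operatorname{vol}_n$ is Euclidean volume. For a compact set $Q$ and nonzero $\alpha\in\mathbb{R}^n$, let $h_\alpha(Q)=\min\{\langle q,\alpha\rangle : q\in Q\}$ and $(Q)_\alpha=\{q\in Q:\langle q,\alpha\rangle=h_\alpha(Q)\}$. A face of a convex polytope $P$ is a subset of the form $(P)_\alpha$ for some nonzero $\alpha$; a face of dimension $0$ is a vertex, other nonempty faces are positive dimensional. *)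

theory Defs
  imports "HOL-Analysis.Analysis"
begin

abbreviation vol :: "(real^'n) set \<Rightarrow> real" where
  "vol A \<equiv> measure lebesgue A"

definition minkowski_comb :: "('n::finite \<Rightarrow> real) \<Rightarrow> ('n \<Rightarrow> (real^'m) set) \<Rightarrow> (real^'m) set" where
  "minkowski_comb lam Q = (\<lambda>q. \<Sum>i\<in>UNIV. lam i *\<^sub>R q i) ` {q. \<forall>i. q i \<in> Q i}"

text \<open>Mixed volume: the coefficient of lambda_1 ... lambda_n in the polynomial
  vol(lambda_1 Q_1 + ... + lambda_n Q_n) (lambda_i > 0). A polynomial in the lambda_i is
  given by a finitely supported coefficient function on exponent vectors alpha :: 'n => nat.\<close>
definition mixed_volume :: "('n::finite \<Rightarrow> (real^'n) set) \<Rightarrow> real" where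
  "mixed_volume Q = (THE c. \<exists>a :: ('n \<Rightarrow> nat) \<Rightarrow> real.
      finite {\<alpha>. a \<alpha> \<noteq> 0} \<and>
      (\<forall>lam. (\<forall>i. lam i > 0) \<longrightarrow>
         vol (minkowski_comb lam Q) = (\<Sum>\<alpha>\<in>{\<alpha>. a \<alpha> \<noteq> 0}. a \<alpha> * (\<Prod>i\<in>UNIV. lam i ^ \<alpha> i))) \<and>
      c = a (\<lambda>_. 1))"

definition h_dir :: "(real^'n) set \<Rightarrow> real^'n \<Rightarrow> real" where
  "h_dir Q \<alpha> = Inf ((\<lambda>q. q \<bullet> \<alpha>) ` Q)"

definition face_dir :: "(real^'n) set \<Rightarrow> real^'n \<Rightarrow> (real^'n) set" where
  "face_dir Q \<alpha> = {q \<in> Q. q \<bullet> \<alpha> = h_dir Q \<alpha>}"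

definition is_face :: "(real^'n) set \<Rightarrow> (real^'n) set \<Rightarrow> bool" where
  "is_face F P \<longleftrightarrow> (\<exists>\<alpha>. \<alpha> \<noteq> 0 \<and> F = face_dir P \<alpha>)"

end

theory Submission
  imports Defs
begin

text \<open>The gradient of log-sum-exp with exponents in a finite set T maps space into conv T, and a
  positive combination of such gradients, with Jacobian matrix J, is a diffeomorphism onto the
  interior of the Minkowski combination of the hulls (unless the sets lie in parallel hyperplanes,
  when the volume and det J vanish). Hence the volume of the combination is the integral of det J.
  Expanding this determinant along its rows exhibits the volume as a polynomial
  and its coefficients, in particular the mixed volume, as integrals of products of Gibbs weights.

  Now let every S i be enlarged to the union A of all S k, with weight 1 on S i and weight t > 0 off
  S i. For every t the mixed volume of the hulls is n! vol (conv A), whereas at t = 0 the weights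
  describe the sets S i themselves. The integrals are continuous at t = 0 by dominated convergence:
  a product of Gibbs weights with nonzero determinant involves n pairs (a, b) with linearly
  independent differences a - b. In a direction where the maximal face of conv A is positive
  dimensional, some pair is not contained in that face while its S i touches it; where the face is a
  vertex v, the pair belonging to an S i that contains v has a point other than v. In both cases a
  Gibbs weight decays exponentially, uniformly in t.\<close>

section \<open>Polynomial functions and their coefficients\<close>

text \<open>Induction on the variables: with the other variables fixed, a polynomial in
  \<open>lam j\<close> that vanishes on the positive half-line has infinitely many roots, so its
  coefficient of degree \<open>\<beta> j\<close> vanishes, which is a relation in the remaining
  variables. Exponents outside \<open>I\<close> cannot be told apart, hence the sum over all
  \<open>\<alpha>\<close> that agree with \<open>\<beta>\<close> on \<open>I\<close>.\<close>

lemma sum_coeffs_eq_0_if_monomial_sum_vanishes: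
  fixes a :: "('n \<Rightarrow> nat) \<Rightarrow> real"
  assumes "finite I" "finite A"
    and "\<And>lam. (\<And>i. lam i > 0) \<Longrightarrow> (\<Sum>\<alpha>\<in>A. a \<alpha> * (\<Prod>i\<in>I. lam i ^ \<alpha> i)) = 0"
  shows "(\<Sum>\<alpha>\<in>{\<alpha>\<in>A. \<forall>i\<in>I. \<alpha> i = \<beta> i}. a \<alpha>) = 0"
  using assms
proof (induction I arbitrary: A rule: finite_induct)
  case empty
  show ?case using empty(2)[of "\<lambda>_. 1"] by simp
next
  case (insert j I)
  have "(\<Sum>\<alpha>\<in>{\<alpha>\<in>A. \<alpha> j = \<beta> j}. a \<alpha> * (\<Prod>i\<in>I. lam i ^ \<alpha> i)) = 0"
    if pos: "\<And>i. lam i > 0" for lam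
  proof -
    define P where "P = (\<Sum>\<alpha>\<in>A. monom (a \<alpha> * (\<Prod>i\<in>I. lam i ^ \<alpha> i)) (\<alpha> j))"
    have "poly P t = 0" if "t > 0" for t
    proof -
      have "(\<Sum>\<alpha>\<in>A. a \<alpha> * (\<Prod>i\<in>insert j I. (lam(j := t)) i ^ \<alpha> i)) = 0"
        by (rule insert.prems(2)) (use pos that in auto)
      moreover have "(\<Prod>i\<in>insert j I. (lam(j := t)) i ^ \<alpha> i) = t ^ \<alpha> j * (\<Prod>i\<in>I. lam i ^ \<alpha> i)" for \<alpha>
      proof -
        have "(\<Prod>i\<in>I. (lam(j := t)) i ^ \<alpha> i) = (\<Prod>i\<in>I. lam i ^ \<alpha> i)"
          using insert.hyps(2) by (intro prod.cong) auto
        then show ?thesis using insert.hyps by simp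
      qed
      ultimately show ?thesis
        by (simp add: P_def poly_sum poly_monom mult_ac)
    qed
    then have "{0<..} \<subseteq> {t. poly P t = 0}" by auto
    then have "P = 0"
      using poly_roots_finite[of P] infinite_Ioi[of "0::real"] finite_subset by blast
    then have "coeff P (\<beta> j) = 0" by simp
    then show ?thesis
      unfolding P_def coeff_sum coeff_monom
      using insert.prems(1) by (simp add: sum.inter_filter if_distrib cong: if_cong)
  qed
  then have "(\<Sum>\<alpha>\<in>{\<alpha>\<in>{\<alpha>\<in>A. \<alpha> j = \<beta> j}. \<forall>i\<in>I. \<alpha> i = \<beta> i}. a \<alpha>) = 0"
    using insert.prems(1) by (intro insert.IH) auto
  moreover have "{\<alpha>\<in>{\<alpha>\<in>A. \<alpha> j = \<beta> j}. \<forall>i\<in>I. \<alpha> i = \<beta> i} = {\<alpha>\<in>A. \<forall>i\<in>insert j I. \<alpha> i = \<beta> i}"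
    by auto
  ultimately show ?case by simp
qed

lemma polynomial_coeff_unique:
  fixes a b :: "('n::finite \<Rightarrow> nat) \<Rightarrow> real"
  assumes "finite {\<alpha>. a \<alpha> \<noteq> 0}" "finite {\<alpha>. b \<alpha> \<noteq> 0}"
    and eq: "\<And>lam. (\<And>i. lam i > 0) \<Longrightarrow>
      (\<Sum>\<alpha>\<in>{\<alpha>. a \<alpha> \<noteq> 0}. a \<alpha> * (\<Prod>i\<in>UNIV. lam i ^ \<alpha> i)) =
      (\<Sum>\<alpha>\<in>{\<alpha>. b \<alpha> \<noteq> 0}. b \<alpha> * (\<Prod>i\<in>UNIV. lam i ^ \<alpha> i))"
  shows "a = b"
proof
  fix \<beta>
  \<comment> \<open>Inserting \<open>\<beta>\<close> makes the filtered set below exactly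
    \<open>{\<beta>}\<close>, even if both coefficients at \<open>\<beta>\<close> are zero.\<close>
  let ?A = "insert \<beta> ({\<alpha>. a \<alpha> \<noteq> 0} \<union> {\<alpha>. b \<alpha> \<noteq> 0})"
  have fin: "finite ?A" using assms by simp
  have "(\<Sum>\<alpha>\<in>?A. (a \<alpha> - b \<alpha>) * (\<Prod>i\<in>UNIV. lam i ^ \<alpha> i)) = 0" if "\<And>i. lam i > 0" for lam :: "'n \<Rightarrow> real"
  proof -
    have 1: "(\<Sum>\<alpha>\<in>{\<alpha>. a \<alpha> \<noteq> 0}. a \<alpha> * (\<Prod>i\<in>UNIV. lam i ^ \<alpha> i)) = (\<Sum>\<alpha>\<in>?A. a \<alpha> * (\<Prod>i\<in>UNIV. lam i ^ \<alpha> i))"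
      using fin by (intro sum.mono_neutral_left) auto
    have 2: "(\<Sum>\<alpha>\<in>{\<alpha>. b \<alpha> \<noteq> 0}. b \<alpha> * (\<Prod>i\<in>UNIV. lam i ^ \<alpha> i)) = (\<Sum>\<alpha>\<in>?A. b \<alpha> * (\<Prod>i\<in>UNIV. lam i ^ \<alpha> i))"
      using fin by (intro sum.mono_neutral_left) auto
    show ?thesis using eq[OF that] 1 2 by (simp only: left_diff_distrib sum_subtractf)
  qed
  then have "(\<Sum>\<alpha>\<in>{\<alpha>\<in>?A. \<forall>i\<in>UNIV. \<alpha> i = \<beta> i}. a \<alpha> - b \<alpha>) = 0"
    using fin by (intro sum_coeffs_eq_0_if_monomial_sum_vanishes) auto
  moreover have "{\<alpha>\<in>?A. \<forall>i\<in>UNIV. \<alpha> i = \<beta> i} = {\<beta>}" by (auto simp: fun_eq_iff)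
  ultimately show "a \<beta> = b \<beta>" by simp
qed

lemma bij_iff_card_fibres_eq_1:
  fixes f :: "'k::finite \<Rightarrow> 'n"
  shows "bij f \<longleftrightarrow> (\<lambda>j. card {k. f k = j}) = (\<lambda>_. 1)"
proof -
  have "card {k. f k = j} = 1 \<longleftrightarrow> (\<exists>!k. f k = j)" for j
    unfolding card_1_singleton_iff One_nat_def by (auto simp: set_eq_iff Ex1_def)
  then show ?thesis by (simp add: bij_iff fun_eq_iff)
qed

text \<open>Different \<open>F\<close> may give the same monomial; its exponent of
  \<open>lam j\<close> is the size of the fibre of \<open>g F\<close> over \<open>j\<close>.
  Grouping by these sizes gives a coefficient function, uniqueness of coefficients justifies the
  definite description, and all exponents are 1 exactly when \<open>g F\<close> is
  bijective.\<close>

lemma mixed_volume_eqI: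
  fixes Q :: "'n::finite \<Rightarrow> (real^'n) set" and g :: "'f \<Rightarrow> 'k::finite \<Rightarrow> 'n"
  assumes fin: "finite \<Phi>"
    and vol: "\<And>lam. (\<And>i. lam i > 0) \<Longrightarrow>
      vol (minkowski_comb lam Q) = (\<Sum>F\<in>\<Phi>. w F * (\<Prod>k\<in>UNIV. lam (g F k)))"
  shows "mixed_volume Q = (\<Sum>F\<in>{F\<in>\<Phi>. bij (g F)}. w F)"
proof -
  define e where "e = (\<lambda>F j. card {k. g F k = j})"
  define a where "a = (\<lambda>\<alpha>. \<Sum>F\<in>{F\<in>\<Phi>. e F = \<alpha>}. w F)"
  have sub: "{\<alpha>. a \<alpha> \<noteq> 0} \<subseteq> e ` \<Phi>"
  proof
    fix \<alpha> assume "\<alpha> \<in> {\<alpha>. a \<alpha> \<noteq> 0}"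
    then have "{F\<in>\<Phi>. e F = \<alpha>} \<noteq> {}" unfolding a_def by force
    then show "\<alpha> \<in> e ` \<Phi>" by auto
  qed
  have fa: "finite {\<alpha>. a \<alpha> \<noteq> 0}" using sub fin by (meson finite_imageI finite_subset)
  have val: "vol (minkowski_comb lam Q) = (\<Sum>\<alpha>\<in>{\<alpha>. a \<alpha> \<noteq> 0}. a \<alpha> * (\<Prod>i\<in>UNIV. lam i ^ \<alpha> i))"
    if "\<And>i. lam i > 0" for lam
  proof -
    have mon: "(\<Prod>k\<in>UNIV. lam (g F k)) = (\<Prod>i\<in>UNIV. lam i ^ e F i)" for F
    proof -
      have "(\<Prod>k\<in>UNIV. lam (g F k)) = (\<Prod>i\<in>UNIV. \<Prod>k\<in>{k\<in>UNIV. g F k = i}. lam (g F k))"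
        by (rule prod.group[symmetric]) auto
      then show ?thesis by (simp add: e_def)
    qed
    have "(\<Sum>\<alpha>\<in>{\<alpha>. a \<alpha> \<noteq> 0}. a \<alpha> * (\<Prod>i\<in>UNIV. lam i ^ \<alpha> i)) =
        (\<Sum>\<alpha>\<in>e ` \<Phi>. a \<alpha> * (\<Prod>i\<in>UNIV. lam i ^ \<alpha> i))"
      using sub fin by (intro sum.mono_neutral_left) auto
    also have "\<dots> = (\<Sum>\<alpha>\<in>e ` \<Phi>. \<Sum>F\<in>{F\<in>\<Phi>. e F = \<alpha>}. w F * (\<Prod>i\<in>UNIV. lam i ^ e F i))"
      unfolding a_def sum_distrib_right by (intro sum.cong) auto
    also have "\<dots> = (\<Sum>F\<in>\<Phi>. w F * (\<Prod>i\<in>UNIV. lam i ^ e F i))"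
      using fin by (intro sum.group) auto
    finally show ?thesis using vol[OF that] by (simp add: mon)
  qed
  have "mixed_volume Q = a (\<lambda>_. 1)"
    unfolding mixed_volume_def
  proof (rule the_equality)
    show "\<exists>b. finite {\<alpha>. b \<alpha> \<noteq> 0} \<and>
      (\<forall>lam. (\<forall>i. lam i > 0) \<longrightarrow>
         vol (minkowski_comb lam Q) = (\<Sum>\<alpha>\<in>{\<alpha>. b \<alpha> \<noteq> 0}. b \<alpha> * (\<Prod>i\<in>UNIV. lam i ^ \<alpha> i))) \<and>
      a (\<lambda>_. 1) = b (\<lambda>_. 1)"
      using fa val by (intro exI[of _ a]) auto
  next
    fix c assume "\<exists>b. finite {\<alpha>. b \<alpha> \<noteq> 0} \<and>
      (\<forall>lam. (\<forall>i. lam i > 0) \<longrightarrow>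
         vol (minkowski_comb lam Q) = (\<Sum>\<alpha>\<in>{\<alpha>. b \<alpha> \<noteq> 0}. b \<alpha> * (\<Prod>i\<in>UNIV. lam i ^ \<alpha> i))) \<and>
      c = b (\<lambda>_. 1)"
    then obtain b where b: "finite {\<alpha>. b \<alpha> \<noteq> 0}" "c = b (\<lambda>_. 1)"
      "\<And>lam. (\<And>i. lam i > 0) \<Longrightarrow>
         vol (minkowski_comb lam Q) = (\<Sum>\<alpha>\<in>{\<alpha>. b \<alpha> \<noteq> 0}. b \<alpha> * (\<Prod>i\<in>UNIV. lam i ^ \<alpha> i))"
      by blast
    have "b = a"
    proof (rule polynomial_coeff_unique[OF b(1) fa])
      fix lam :: "'n \<Rightarrow> real" assume "\<And>i. lam i > 0"
      then show "(\<Sum>\<alpha>\<in>{\<alpha>. b \<alpha> \<noteq> 0}. b \<alpha> * (\<Prod>i\<in>UNIV. lam i ^ \<alpha> i)) =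
          (\<Sum>\<alpha>\<in>{\<alpha>. a \<alpha> \<noteq> 0}. a \<alpha> * (\<Prod>i\<in>UNIV. lam i ^ \<alpha> i))"
        using b(3)[of lam] val[of lam] by simp
    qed
    then show "c = a (\<lambda>_. 1)" using b(2) by simp
  qed
  also have "\<dots> = (\<Sum>F\<in>{F\<in>\<Phi>. bij (g F)}. w F)"
    unfolding a_def e_def bij_iff_card_fibres_eq_1 ..
  finally show ?thesis .
qed

lemma mixed_volume_eq_0I:
  fixes Q :: "'n::finite \<Rightarrow> (real^'n) set"
  assumes "\<And>lam. (\<And>i. lam i > 0) \<Longrightarrow> vol (minkowski_comb lam Q) = 0"
  shows "mixed_volume Q = 0"
  using mixed_volume_eqI[of "{}" Q "\<lambda>_. 0" "\<lambda>_. id"] assms by simp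

section \<open>Equal arguments, and determinants whose rows are sums\<close>

lemma minkowski_comb_const:
  fixes P :: "(real^'m) set" and lam :: "'n::finite \<Rightarrow> real"
  assumes "convex P" and pos: "\<And>i. lam i > 0"
  shows "minkowski_comb lam (\<lambda>_. P) = (\<lambda>x. (\<Sum>i\<in>UNIV. lam i) *\<^sub>R x) ` P"
proof
  let ?L = "\<Sum>i\<in>UNIV. lam i"
  have L: "?L > 0" by (intro sum_pos) (use pos in auto)
  show "minkowski_comb lam (\<lambda>_. P) \<subseteq> (\<lambda>x. ?L *\<^sub>R x) ` P"
  proof (clarsimp simp: minkowski_comb_def)
    fix q :: "'n \<Rightarrow> real^'m" assume q: "\<forall>i. q i \<in> P"
    have "(\<Sum>i\<in>UNIV. (lam i / ?L) *\<^sub>R q i) \<in> P"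
      using assms q L by (intro convex_sum) (auto simp: less_imp_le simp flip: sum_divide_distrib)
    moreover have "(\<Sum>i\<in>UNIV. lam i *\<^sub>R q i) = ?L *\<^sub>R (\<Sum>i\<in>UNIV. (lam i / ?L) *\<^sub>R q i)"
      using L by (simp add: scaleR_sum_right)
    ultimately show "(\<Sum>i\<in>UNIV. lam i *\<^sub>R q i) \<in> (\<lambda>x. ?L *\<^sub>R x) ` P" by blast
  qed
  show "(\<lambda>x. ?L *\<^sub>R x) ` P \<subseteq> minkowski_comb lam (\<lambda>_. P)"
    unfolding minkowski_comb_def by (force simp: scaleR_sum_left)
qed

text \<open>The volume scales by the n-th power of the sum of the \<open>lam i\<close>. Expanded
  over all maps \<open>F\<close>, this power contributes one term for each of the n!
  permutations.\<close>

lemma mixed_volume_const: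
  fixes P :: "(real^'n::finite) set"
  assumes "convex P"
  shows "mixed_volume (\<lambda>_. P) = fact CARD('n) * vol P"
proof -
  have "mixed_volume (\<lambda>_. P) = (\<Sum>F\<in>{F\<in>UNIV. bij (F :: 'n \<Rightarrow> 'n)}. vol P)"
  proof (rule mixed_volume_eqI)
    fix lam :: "'n \<Rightarrow> real" assume pos: "\<And>i. lam i > 0"
    have "vol (minkowski_comb lam (\<lambda>_. P)) = (\<Sum>i\<in>UNIV. lam i) ^ CARD('n) * vol P"
      using measure_lebesgue_affine[of "\<Sum>i\<in>UNIV. lam i" 0 P] pos
      by (simp add: minkowski_comb_const[OF assms pos] sum_nonneg less_imp_le)
    also have "(\<Sum>i\<in>UNIV. lam i) ^ CARD('n) = (\<Prod>k\<in>(UNIV::'n set). \<Sum>i\<in>UNIV. lam i)"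
      by simp
    also have "\<dots> = (\<Sum>F\<in>UNIV. \<Prod>k\<in>(UNIV::'n set). lam (F k))"
      by (subst prod_sum_PiE) (auto simp: PiE_UNIV_domain)
    finally show "vol (minkowski_comb lam (\<lambda>_. P)) = (\<Sum>F\<in>UNIV. vol P * (\<Prod>k\<in>(UNIV::'n set). lam (F k)))"
      by (simp add: sum_distrib_left mult.commute)
  qed simp
  also have "{F\<in>UNIV. bij (F :: 'n \<Rightarrow> 'n)} = {p. p permutes UNIV}"
    by (auto simp: permutes_def bij_iff)
  also have "(\<Sum>F\<in>\<dots>. vol P) = fact CARD('n) * vol P"
    by (simp add: card_permutations[OF refl])
  finally show ?thesis .
qed

text \<open>Multilinearity in all rows at once: in the Leibniz formula each product of sums becomes
  a sum over choice functions \<open>F\<close>.\<close>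

lemma det_sum_rows:
  fixes a :: "'k::finite \<Rightarrow> 'b \<Rightarrow> real^'k"
  assumes "finite J"
  shows "det (\<chi> k. \<Sum>j\<in>J. a k j) = (\<Sum>F\<in>PiE UNIV (\<lambda>_. J). det (\<chi> k. a k (F k)))"
  using assms
  by (simp add: det_def prod_sum_PiE sum_distrib_left) (rule sum.swap)

section \<open>Exponential decay\<close>

lemma integrable_exp_neg_abs:
  assumes "d > 0"
  shows "integrable lborel (\<lambda>t::real. exp (- d * \<bar>t\<bar>))"
proof -
  have pos: "(\<lambda>t. exp (- d * t)) absolutely_integrable_on {0..}"
    using integrable_on_exp_minus_to_infinity[OF assms, of 0]
    by (subst absolutely_integrable_on_iff_nonneg) auto
  have neg: "(\<lambda>t. exp (- d * - t)) absolutely_integrable_on {..0}"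
    using has_absolute_integral_reflect_real[of "{..0}" "{0..}" "\<lambda>t. exp (- d * t)" "integral {0..} (\<lambda>t. exp (- d * t))"] pos
    by auto
  have "(\<lambda>t. exp (- d * \<bar>t\<bar>)) absolutely_integrable_on {0..}"
    using pos by (rule set_integrable_cong[THEN iffD1, rotated -1]) auto
  moreover have "(\<lambda>t. exp (- d * \<bar>t\<bar>)) absolutely_integrable_on {..0}"
    using neg by (rule set_integrable_cong[THEN iffD1, rotated -1]) auto
  ultimately have "(\<lambda>t. exp (- d * \<bar>t\<bar>)) absolutely_integrable_on ({0..} \<union> {..0})"
    by (rule absolutely_integrable_Un)
  moreover have "{0..} \<union> {..0} = (UNIV :: real set)" by auto
  ultimately have "integrable lebesgue (\<lambda>t. exp (- d * \<bar>t\<bar>))"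
    by (simp add: set_integrable_def)
  then show ?thesis by (subst (asm) integrable_completion) auto
qed

lemma integrable_exp_neg_norm:
  assumes "e > 0"
  shows "(\<lambda>x::'a::euclidean_space. exp (- e * norm x)) integrable_on UNIV"
proof -
  \<comment> \<open>The sum of the absolute coordinates is at most \<open>DIM('a) * norm x\<close>,
    so this rate puts the function below a product of one-dimensional exponentials.\<close>
  define d where "d = e / DIM('a)"
  have d: "d > 0" using assms by (simp add: d_def)
  have "(\<integral>\<^sup>+x. (\<Prod>b\<in>Basis. exp (- d * \<bar>x \<bullet> b\<bar>)) \<partial>(lborel :: 'a measure)) =
      (\<Prod>b\<in>(Basis :: 'a set). \<integral>\<^sup>+t. exp (- d * \<bar>t\<bar>) \<partial>lborel)"
    using nn_integral_lborel_prod[where 'a = 'a and f = "\<lambda>_ t. ennreal (exp (- d * \<bar>t\<bar>))"]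
    by (simp add: prod_ennreal)
  also have "\<dots> < \<infinity>"
    using integrable_exp_neg_abs[OF d] by (simp add: integrable_iff_bounded power_less_top_ennreal)
  finally have prod: "integrable lborel (\<lambda>x::'a. \<Prod>b\<in>Basis. exp (- d * \<bar>x \<bullet> b\<bar>))"
    by (intro integrableI_nonneg) (auto intro!: prod_nonneg)
  have "integrable lborel (\<lambda>x::'a. exp (- e * norm x))"
  proof (rule Bochner_Integration.integrable_bound[OF prod])
    show "AE x in lborel. norm (exp (- e * norm (x::'a))) \<le> norm (\<Prod>b\<in>Basis. exp (- d * \<bar>x \<bullet> b\<bar>))"
    proof (rule AE_I2)
      fix x :: 'a
      have "(\<Sum>b\<in>Basis. \<bar>x \<bullet> b\<bar>) \<le> DIM('a) * norm x"
        using sum_bounded_above[of Basis "\<lambda>b. \<bar>x \<bullet> b\<bar>" "norm x"] by (simp add: Basis_le_norm)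
      then have "d * (\<Sum>b\<in>Basis. \<bar>x \<bullet> b\<bar>) \<le> e * norm x"
        using d mult_left_mono[of _ "DIM('a) * norm x" d] by (fastforce simp: d_def)
      then show "norm (exp (- e * norm x)) \<le> norm (\<Prod>b\<in>Basis. exp (- d * \<bar>x \<bullet> b\<bar>))"
        by (simp add: exp_sum[symmetric] sum_negf sum_distrib_left)
    qed
  qed simp
  then show ?thesis by (rule integrable_on_lborel)
qed

text \<open>By homogeneity the unit sphere suffices. There the sum of the positive parts of
  \<open>d \<bullet> x\<close> is continuous and positive, so it has a positive minimum, and some
  \<open>d\<close> reaches at least the average.\<close>

lemma uniform_positive_direction:
  fixes D :: "'a::euclidean_space set"
  assumes D: "finite D" and pos: "\<And>x. x \<noteq> 0 \<Longrightarrow> \<exists>d\<in>D. 0 < d \<bullet> x"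
  obtains e where "e > 0" "\<And>x. \<exists>d\<in>D. e * norm x \<le> d \<bullet> x"
proof -
  define g where "g = (\<lambda>x. \<Sum>d\<in>D. max 0 (d \<bullet> x))"
  have "continuous_on (sphere 0 1) g"
    unfolding g_def by (intro continuous_intros)
  moreover obtain b :: 'a where "b \<in> Basis" using nonempty_Basis by blast
  then have b: "b \<noteq> 0" "norm b = 1" by auto
  ultimately obtain z where z: "norm z = 1" "\<And>u. norm u = 1 \<Longrightarrow> g z \<le> g u"
    using continuous_attains_inf[of "sphere (0::'a) 1" g] by (metis compact_sphere dist_0_norm empty_iff mem_sphere)
  have Dne: "D \<noteq> {}" using pos b by blast
  obtain d where "d \<in> D" "0 < d \<bullet> z" using pos[of z] z(1) by force
  then have gz: "g z > 0"
    unfolding g_def using D by (intro sum_pos2[of D d]) auto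
  define e where "e = g z / card D"
  have card: "card D > 0" using D Dne by (simp add: card_gt_0_iff)
  have "\<exists>d\<in>D. e * norm x \<le> d \<bullet> x" for x
  proof (cases "x = 0")
    case False
    define u where "u = x /\<^sub>R norm x"
    have u: "norm u = 1" "x = norm x *\<^sub>R u" using False by (auto simp: u_def)
    have "\<exists>d\<in>D. e \<le> d \<bullet> u"
    proof (rule ccontr)
      assume "\<not> ?thesis"
      then have "g u < (\<Sum>d\<in>D. e)"
        unfolding g_def using D Dne gz card by (intro sum_strict_mono) (auto simp: e_def)
      also have "\<dots> = g z" using card by (simp add: e_def)
      finally show False using z(2)[OF u(1)] by simp
    qed
    then obtain d where "d \<in> D" "e \<le> d \<bullet> u" by blast
    moreover have "d \<bullet> x = norm x * (d \<bullet> u)" by (subst u(2)) simp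
    moreover have "e * norm x \<le> norm x * (d \<bullet> u)"
      using \<open>e \<le> d \<bullet> u\<close> mult_left_mono[of e "d \<bullet> u" "norm x"] by (simp add: mult.commute)
    ultimately show ?thesis by force
  qed (use Dne in auto)
  then show thesis using that[of e] gz card by (simp add: e_def)
qed

text \<open>The bound on \<open>y\<close> is assumed for every \<open>d\<close> in \<open>D\<close>,
  so at each \<open>x\<close> the \<open>d\<close> with
  \<open>e * norm x \<le> d \<bullet> x\<close> may be chosen. The function \<open>h\<close> depends
  only on \<open>D\<close> and \<open>C\<close>.\<close>

lemma integrable_exp_dominator:
  fixes D :: "'a::euclidean_space set"
  assumes D: "finite D" and pos: "\<And>x. x \<noteq> 0 \<Longrightarrow> \<exists>d\<in>D. 0 < d \<bullet> x" and "C \<ge> 0"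
  obtains h :: "'a \<Rightarrow> real" where "h integrable_on UNIV"
    "\<And>x y. (\<And>d. d \<in> D \<Longrightarrow> y \<le> C * exp (- (d \<bullet> x))) \<Longrightarrow> y \<le> h x"
proof -
  obtain e where e: "e > 0" "\<And>x. \<exists>d\<in>D. e * norm x \<le> d \<bullet> x"
    using uniform_positive_direction[OF D pos] by blast
  show thesis
  proof
    show "(\<lambda>x. C * exp (- e * norm x)) integrable_on UNIV"
      using integrable_exp_neg_norm[OF e(1)] by (rule integrable_on_mult_right)
    fix x y assume *: "\<And>d. d \<in> D \<Longrightarrow> y \<le> C * exp (- (d \<bullet> x))"
    obtain d where d: "d \<in> D" "e * norm x \<le> d \<bullet> x" using e(2) by blast
    have "y \<le> C * exp (- (d \<bullet> x))" using * d(1) .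
    also have "\<dots> \<le> C * exp (- e * norm x)" using d(2) assms(3) by (intro mult_left_mono) auto
    finally show "y \<le> C * exp (- e * norm x)" .
  qed
qed

section \<open>Gibbs weights and the gradient of log-sum-exp\<close>

definition expsum :: "'a::real_inner set \<Rightarrow> ('a \<Rightarrow> real) \<Rightarrow> 'a \<Rightarrow> real" where
  "expsum A c x = (\<Sum>s\<in>A. c s * exp (s \<bullet> x))"

definition gibbs :: "'a::real_inner set \<Rightarrow> ('a \<Rightarrow> real) \<Rightarrow> 'a \<Rightarrow> 'a \<Rightarrow> real" where
  "gibbs A c x s = c s * exp (s \<bullet> x) / expsum A c x"

text \<open>The gradient of log-sum-exp, also known as the moment map of the exponential
  sum.\<close>

definition gibbs_mean :: "'a::real_inner set \<Rightarrow> ('a \<Rightarrow> real) \<Rightarrow> 'a \<Rightarrow> 'a" where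
  "gibbs_mean A c x = (\<Sum>s\<in>A. gibbs A c x s *\<^sub>R s)"

text \<open>The Hessian of log-sum-exp, that is, the covariance of the Gibbs distribution. Summing
  over ordered pairs makes each row of its matrix a combination of differences
  \<open>a - b\<close>.\<close>

definition gibbs_mean_deriv :: "'a::real_inner set \<Rightarrow> ('a \<Rightarrow> real) \<Rightarrow> 'a \<Rightarrow> 'a \<Rightarrow> 'a" where
  "gibbs_mean_deriv A c x v =
     (\<Sum>a\<in>A. \<Sum>b\<in>A. (gibbs A c x a * gibbs A c x b * ((a - b) \<bullet> v)) *\<^sub>R a)"

text \<open>Zero weights are allowed, so that subsets of \<open>A\<close> can be described by
  weights on all of \<open>A\<close>; one positive weight keeps \<open>expsum\<close>
  positive.\<close>

definition weight_system :: "'a set \<Rightarrow> ('a \<Rightarrow> real) \<Rightarrow> bool" where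
  "weight_system A c \<longleftrightarrow> finite A \<and> (\<forall>s\<in>A. c s \<ge> 0) \<and> (\<exists>s\<in>A. c s > 0)"

lemma expsum_ge:
  assumes "weight_system A c" "s \<in> A"
  shows "c s * exp (s \<bullet> x) \<le> expsum A c x"
  unfolding expsum_def using assms
  by (intro member_le_sum) (auto simp: weight_system_def)

lemma expsum_pos:
  assumes "weight_system A c"
  shows "expsum A c x > 0"
proof -
  obtain s where "s \<in> A" "c s > 0" using assms by (auto simp: weight_system_def)
  then have "0 < c s * exp (s \<bullet> x)" by simp
  also have "\<dots> \<le> expsum A c x" using assms \<open>s \<in> A\<close> by (rule expsum_ge)
  finally show ?thesis .
qed

lemma gibbs_nonneg: "weight_system A c \<Longrightarrow> s \<in> A \<Longrightarrow> 0 \<le> gibbs A c x s"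
  using expsum_pos[of A c x] by (simp add: gibbs_def weight_system_def)

lemma gibbs_pos: "weight_system A c \<Longrightarrow> c s > 0 \<Longrightarrow> 0 < gibbs A c x s"
  using expsum_pos[of A c x] by (simp add: gibbs_def)

lemma gibbs_le_1: "weight_system A c \<Longrightarrow> s \<in> A \<Longrightarrow> gibbs A c x s \<le> 1"
  using expsum_ge[of A c s x] expsum_pos[of A c x] by (simp add: gibbs_def)

lemma sum_gibbs: "weight_system A c \<Longrightarrow> (\<Sum>s\<in>A. gibbs A c x s) = 1"
  using expsum_pos[of A c x]
  by (simp add: gibbs_def sum_divide_distrib[symmetric]) (simp add: expsum_def)

text \<open>The denominator is at least its single summand at \<open>u\<close>, and
  \<open>c s\<close> is at most \<open>C\<close> times the weight of that summand.\<close>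

lemma gibbs_le_exp:
  assumes "weight_system A c" "s \<in> A" "u \<in> A" "c s \<le> C * c u" "c u > 0"
  shows "gibbs A c x s \<le> C * exp (- ((u - s) \<bullet> x))"
proof -
  have Z: "expsum A c x > 0" using assms(1) by (rule expsum_pos)
  have C: "C \<ge> 0"
    using assms by (metis mult_less_0_iff linorder_not_le order.trans weight_system_def)
  have "c s * exp (s \<bullet> x) \<le> C * c u * exp (s \<bullet> x)"
    using assms(4) by (rule mult_right_mono) simp
  also have "\<dots> = C * exp (- ((u - s) \<bullet> x)) * (c u * exp (u \<bullet> x))"
    by (simp add: inner_diff_left exp_diff)
  also have "\<dots> \<le> C * exp (- ((u - s) \<bullet> x)) * expsum A c x"
    using assms C by (intro mult_left_mono expsum_ge) auto
  finally show ?thesis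
    using Z by (simp add: gibbs_def field_simps)
qed

lemma has_derivative_expsum:
  "(expsum A c has_derivative (\<lambda>v. \<Sum>s\<in>A. c s * exp (s \<bullet> x) * (s \<bullet> v))) (at x)"
  unfolding expsum_def[abs_def]
  by (auto intro!: derivative_eq_intros sum.cong simp: mult_ac)

lemma sum_gibbs_mult_expsum:
  assumes "weight_system A c"
  shows "(\<Sum>s\<in>A. c s * exp (s \<bullet> x) * f s) = expsum A c x * (\<Sum>s\<in>A. gibbs A c x s * f s)"
  using expsum_pos[OF assms, of x] by (simp add: gibbs_def sum_distrib_left)

lemma has_derivative_ln_expsum:
  assumes "weight_system A c"
  shows "((\<lambda>x. ln (expsum A c x)) has_derivative (\<lambda>v. gibbs_mean A c x \<bullet> v)) (at x)"
proof -
  have "((\<lambda>x. ln (expsum A c x)) has_derivative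
      (\<lambda>v. (\<Sum>s\<in>A. c s * exp (s \<bullet> x) * (s \<bullet> v)) * inverse (expsum A c x))) (at x)"
    by (rule has_derivative_ln[OF expsum_pos[OF assms] has_derivative_expsum])
  moreover have "(\<Sum>s\<in>A. c s * exp (s \<bullet> x) * (s \<bullet> v)) * inverse (expsum A c x) = gibbs_mean A c x \<bullet> v" for v
    using expsum_pos[OF assms, of x]
    by (simp add: sum_gibbs_mult_expsum[OF assms] gibbs_mean_def inner_sum_left)
  ultimately show ?thesis by simp
qed

lemma has_derivative_gibbs:
  assumes "weight_system A c"
  shows "((\<lambda>x. gibbs A c x a) has_derivative
    (\<lambda>v. \<Sum>b\<in>A. gibbs A c x a * gibbs A c x b * ((a - b) \<bullet> v))) (at x)"
proof -
  define Z where "Z = expsum A c x"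
  have Z: "Z > 0" using expsum_pos[OF assms] by (simp add: Z_def)
  define M where "M = (\<lambda>v. \<Sum>b\<in>A. gibbs A c x b * (b \<bullet> v))"
  have "((\<lambda>x. c a * exp (a \<bullet> x)) has_derivative (\<lambda>v. c a * exp (a \<bullet> x) * (a \<bullet> v))) (at x)"
    by (auto intro!: derivative_eq_intros)
  moreover have "(expsum A c has_derivative (\<lambda>v. Z * M v)) (at x)"
    using has_derivative_expsum[of A c x] by (simp add: sum_gibbs_mult_expsum[OF assms] Z_def M_def)
  ultimately have "((\<lambda>x. c a * exp (a \<bullet> x) / expsum A c x) has_derivative
    (\<lambda>v. (c a * exp (a \<bullet> x) * (a \<bullet> v) * Z - c a * exp (a \<bullet> x) * (Z * M v)) / (Z * Z))) (at x)"
    using Z unfolding Z_def by (intro has_derivative_divide') auto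
  moreover have "(c a * exp (a \<bullet> x) * (a \<bullet> v) * Z - c a * exp (a \<bullet> x) * (Z * M v)) / (Z * Z) =
      (\<Sum>b\<in>A. gibbs A c x a * gibbs A c x b * ((a - b) \<bullet> v))" for v
  proof -
    \<comment> \<open>Since the Gibbs weights sum to 1, the quotient rule's difference between
      \<open>a \<bullet> v\<close> and its mean becomes a mean of differences.\<close>
    have "(\<Sum>b\<in>A. gibbs A c x a * gibbs A c x b * ((a - b) \<bullet> v)) =
        gibbs A c x a * ((\<Sum>b\<in>A. gibbs A c x b) * (a \<bullet> v) - M v)"
      by (simp add: M_def inner_diff_left algebra_simps sum_subtractf sum_distrib_left sum_distrib_right)
    also have "\<dots> = gibbs A c x a * (a \<bullet> v - M v)"
      by (simp add: sum_gibbs[OF assms])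
    also have "\<dots> = (c a * exp (a \<bullet> x) * (a \<bullet> v) * Z - c a * exp (a \<bullet> x) * (Z * M v)) / (Z * Z)"
      using Z by (simp add: gibbs_def Z_def[symmetric] field_simps)
    finally show ?thesis ..
  qed
  ultimately show ?thesis by (simp add: gibbs_def[abs_def])
qed

lemma continuous_on_gibbs:
  assumes "weight_system A c"
  shows "continuous_on X (\<lambda>x. gibbs A c x a)"
  using has_derivative_gibbs[OF assms]
  by (intro has_derivative_continuous_on) (rule has_derivative_at_withinI)

lemma has_derivative_gibbs_mean:
  assumes "weight_system A c"
  shows "(gibbs_mean A c has_derivative gibbs_mean_deriv A c x) (at x)"
  unfolding gibbs_mean_def[abs_def] gibbs_mean_deriv_def[abs_def] scaleR_sum_left[symmetric]
  by (intro has_derivative_sum has_derivative_scaleR_left has_derivative_gibbs[OF assms])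

text \<open>Adding the double sum to its copy with \<open>a\<close> and \<open>b\<close> exchanged
  completes the square; the result is twice the variance of \<open>a \<bullet> v\<close>.\<close>

lemma inner_gibbs_mean_deriv:
  "2 * (gibbs_mean_deriv A c x v \<bullet> v) =
     (\<Sum>a\<in>A. \<Sum>b\<in>A. gibbs A c x a * gibbs A c x b * ((a - b) \<bullet> v)\<^sup>2)"
proof -
  let ?g = "gibbs A c x"
  have 1: "gibbs_mean_deriv A c x v \<bullet> v = (\<Sum>a\<in>A. \<Sum>b\<in>A. ?g a * ?g b * ((a - b) \<bullet> v) * (a \<bullet> v))"
    by (simp add: gibbs_mean_deriv_def inner_sum_left)
  have 2: "gibbs_mean_deriv A c x v \<bullet> v = (\<Sum>a\<in>A. \<Sum>b\<in>A. ?g b * ?g a * ((b - a) \<bullet> v) * (b \<bullet> v))"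
    unfolding 1 by (rule sum.swap)
  have "2 * (gibbs_mean_deriv A c x v \<bullet> v) =
      (\<Sum>a\<in>A. \<Sum>b\<in>A. ?g a * ?g b * ((a - b) \<bullet> v) * (a \<bullet> v)) +
      (\<Sum>a\<in>A. \<Sum>b\<in>A. ?g b * ?g a * ((b - a) \<bullet> v) * (b \<bullet> v))"
    using 1 2 by linarith
  also have "\<dots> = (\<Sum>a\<in>A. \<Sum>b\<in>A. ?g a * ?g b * ((a - b) \<bullet> v)\<^sup>2)"
    unfolding sum.distrib[symmetric]
    by (intro sum.cong refl) (simp add: inner_diff_left power2_eq_square algebra_simps)
  finally show ?thesis .
qed

text \<open>The support of the weights lies in one hyperplane orthogonal to \<open>v\<close>. These
  are the directions in which the covariance degenerates.\<close>

definition flat_direction :: "'a::real_inner set \<Rightarrow> ('a \<Rightarrow> real) \<Rightarrow> 'a \<Rightarrow> bool" where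
  "flat_direction A c v \<longleftrightarrow> (\<forall>a\<in>A. \<forall>b\<in>A. c a > 0 \<longrightarrow> c b > 0 \<longrightarrow> (a - b) \<bullet> v = 0)"

lemma inner_gibbs_mean_deriv_nonneg:
  assumes "weight_system A c"
  shows "0 \<le> gibbs_mean_deriv A c x v \<bullet> v"
proof -
  have "0 \<le> 2 * (gibbs_mean_deriv A c x v \<bullet> v)"
    unfolding inner_gibbs_mean_deriv using assms
    by (intro sum_nonneg mult_nonneg_nonneg gibbs_nonneg) auto
  then show ?thesis by simp
qed

lemma inner_gibbs_mean_deriv_pos:
  assumes "weight_system A c" "\<not> flat_direction A c v"
  shows "0 < gibbs_mean_deriv A c x v \<bullet> v"
proof -
  let ?t = "\<lambda>a b. gibbs A c x a * gibbs A c x b * ((a - b) \<bullet> v)\<^sup>2"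
  have fin: "finite A" using assms by (simp add: weight_system_def)
  have nn: "0 \<le> ?t a b" if "a \<in> A" "b \<in> A" for a b
    using assms(1) that by (intro mult_nonneg_nonneg gibbs_nonneg) auto
  obtain a b where ab: "a \<in> A" "b \<in> A" "c a > 0" "c b > 0" "(a - b) \<bullet> v \<noteq> 0"
    using assms(2) by (auto simp: flat_direction_def)
  have "0 < ?t a b" using ab gibbs_pos[OF assms(1)] by simp
  also have "\<dots> \<le> (\<Sum>b\<in>A. ?t a b)"
    using fin nn ab by (intro member_le_sum) auto
  also have "\<dots> \<le> (\<Sum>a\<in>A. \<Sum>b\<in>A. ?t a b)"
    using fin nn ab by (intro member_le_sum[of a A "\<lambda>a. \<Sum>b\<in>A. ?t a b"] sum_nonneg) auto
  also have "\<dots> = 2 * (gibbs_mean_deriv A c x v \<bullet> v)"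
    unfolding inner_gibbs_mean_deriv ..
  finally show ?thesis by simp
qed

lemma gibbs_mean_deriv_flat:
  assumes "weight_system A c" "flat_direction A c v"
  shows "gibbs_mean_deriv A c x v = 0"
proof -
  have "gibbs A c x a * gibbs A c x b * ((a - b) \<bullet> v) = 0" if "a \<in> A" "b \<in> A" for a b
  proof (cases "c a > 0 \<and> c b > 0")
    case False
    then have "c a = 0 \<or> c b = 0" using assms(1) that by (force simp: weight_system_def)
    then show ?thesis by (auto simp: gibbs_def)
  qed (use assms(2) that in \<open>simp add: flat_direction_def\<close>)
  then show ?thesis unfolding gibbs_mean_deriv_def by (intro sum.neutral ballI) simp
qed

section \<open>Volumes of Minkowski combinations as integrals\<close>

lemma det_eq_0_iff_kernel:
  fixes M :: "real^'m^'m"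
  shows "det M = 0 \<longleftrightarrow> (\<exists>v. v \<noteq> 0 \<and> M *v v = 0)"
  using det_eq_0_rank[of M] less_rank_noninjective[of M] matrix_nonfull_linear_equations_eq[of M] rank_bound[of M]
  by (auto simp: less_le)

text \<open>Every matrix on the segment from the identity to \<open>M\<close> is positive definite,
  hence invertible. The determinant starts at 1 and cannot change sign along it.\<close>

lemma det_pos_if_positive_definite:
  fixes M :: "real^'m^'m"
  assumes pos: "\<And>v. v \<noteq> 0 \<Longrightarrow> (M *v v) \<bullet> v > 0"
  shows "det M > 0"
proof (rule ccontr)
  define N where "N = (\<lambda>t. (1 - t) *\<^sub>R mat 1 + t *\<^sub>R M)"
  have nz: "det (N t) \<noteq> 0" if "0 \<le> t" "t \<le> 1" for t
  proof
    assume "det (N t) = 0"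
    then obtain v where v: "v \<noteq> 0" "N t *v v = 0"
      using det_eq_0_iff_kernel by blast
    have "(N t *v v) \<bullet> v = (1 - t) * (v \<bullet> v) + t * ((M *v v) \<bullet> v)"
      by (simp add: N_def matrix_vector_mult_add_rdistrib scaleR_matrix_vector_assoc[symmetric] inner_add_left)
    also have "\<dots> > 0"
    proof (cases "t = 0")
      case False
      then have "t * ((M *v v) \<bullet> v) > 0" using that pos[OF v(1)] by simp
      moreover have "(1 - t) * (v \<bullet> v) \<ge> 0" using that by simp
      ultimately show ?thesis by linarith
    qed (use v in simp)
    finally show False using v(2) by simp
  qed
  assume "\<not> det M > 0"
  then have "det (N 1) \<le> 0" "0 \<le> det (N 0)" by (simp_all add: N_def)
  moreover have "continuous_on {0..1} (\<lambda>t. det (N t))"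
    unfolding N_def det_def by (intro continuous_intros)
  ultimately obtain t where "0 \<le> t" "t \<le> 1" "det (N t) = 0"
    using IVT2'[of "\<lambda>t. det (N t)" 1 0 0] by auto
  then show False using nz by blast
qed

section \<open>The combined gradient map and its image\<close>

lemma minkowski_combI: "(\<And>i. q i \<in> Q i) \<Longrightarrow> (\<Sum>i\<in>UNIV. lam i *\<^sub>R q i) \<in> minkowski_comb lam Q"
  by (auto simp: minkowski_comb_def)

lemma minkowski_combE:
  assumes "z \<in> minkowski_comb lam Q"
  obtains q where "\<And>i. q i \<in> Q i" "z = (\<Sum>i\<in>UNIV. lam i *\<^sub>R q i)"
  using assms by (auto simp: minkowski_comb_def)

lemma convex_minkowski_comb:
  assumes "\<And>i. convex (Q i)"
  shows "convex (minkowski_comb lam Q)"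
proof (rule convexI)
  fix x y and u v :: real
  assume "x \<in> minkowski_comb lam Q" "y \<in> minkowski_comb lam Q" and uv: "0 \<le> u" "0 \<le> v" "u + v = 1"
  then obtain p q where p: "\<And>i. p i \<in> Q i" "x = (\<Sum>i\<in>UNIV. lam i *\<^sub>R p i)"
    and q: "\<And>i. q i \<in> Q i" "y = (\<Sum>i\<in>UNIV. lam i *\<^sub>R q i)"
    unfolding minkowski_comb_def by blast
  have *: "u *\<^sub>R x + v *\<^sub>R y = (\<Sum>i\<in>UNIV. lam i *\<^sub>R (u *\<^sub>R p i + v *\<^sub>R q i))"
    by (simp add: p q scaleR_sum_right sum.distrib scaleR_add_right mult.commute)
  show "u *\<^sub>R x + v *\<^sub>R y \<in> minkowski_comb lam Q"
    unfolding * using assms p(1) q(1) uv by (intro minkowski_combI) (simp add: convexD)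
qed

context
  fixes A :: "(real^'m) set" and c :: "'n::finite \<Rightarrow> real^'m \<Rightarrow> real" and lam :: "'n \<Rightarrow> real"
begin

definition newton_polytope :: "'n \<Rightarrow> (real^'m) set" where
  "newton_polytope i = convex hull {s \<in> A. c i s > 0}"

text \<open>The gradient of the sum of the \<open>lam i * ln (expsum A (c i) x)\<close>.\<close>

definition mixed_mean :: "real^'m \<Rightarrow> real^'m" where
  "mixed_mean x = (\<Sum>i\<in>UNIV. lam i *\<^sub>R gibbs_mean A (c i) x)"

definition mixed_mean_deriv :: "real^'m \<Rightarrow> real^'m \<Rightarrow> real^'m" where
  "mixed_mean_deriv x v = (\<Sum>i\<in>UNIV. lam i *\<^sub>R gibbs_mean_deriv A (c i) x v)"

context
  assumes ws: "\<And>i. weight_system A (c i)" and lam: "\<And>i. lam i > 0"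
begin

lemma has_derivative_mixed_mean: "(mixed_mean has_derivative mixed_mean_deriv x) (at x)"
  unfolding mixed_mean_def[abs_def] mixed_mean_deriv_def[abs_def]
  by (intro has_derivative_sum has_derivative_scaleR_right has_derivative_gibbs_mean[OF ws])

text \<open>Exponents of weight 0 have Gibbs weight 0, so the mean is a convex combination of the
  support alone.\<close>

lemma gibbs_mean_in_newton_polytope: "gibbs_mean A (c i) x \<in> newton_polytope i"
proof -
  let ?T = "{s \<in> A. c i s > 0}"
  have fin: "finite A" using ws[of i] by (simp add: weight_system_def)
  have z: "gibbs A (c i) x s = 0" if "s \<in> A - ?T" for s
    using that ws[of i] by (force simp: weight_system_def gibbs_def)
  have "gibbs_mean A (c i) x = (\<Sum>s\<in>?T. gibbs A (c i) x s *\<^sub>R s)"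
    unfolding gibbs_mean_def using fin z by (intro sum.mono_neutral_right) auto
  moreover have "(\<Sum>s\<in>?T. gibbs A (c i) x s) = 1"
    unfolding sum_gibbs[OF ws[of i], of x, symmetric]
    using fin z by (intro sum.mono_neutral_left) auto
  ultimately show ?thesis
    unfolding newton_polytope_def using fin gibbs_nonneg[OF ws[of i]] convex_convex_hull
    by (simp only:) (rule convex_sum, auto intro: hull_inc)
qed

lemma range_mixed_mean_subset: "range mixed_mean \<subseteq> minkowski_comb lam newton_polytope"
  unfolding mixed_mean_def using gibbs_mean_in_newton_polytope by (auto intro!: minkowski_combI)

text \<open>The preimage of an interior point y is found by minimising the
  function that maps x to the sum of the lam i * ln (expsum A (c i) x) minus y \<bullet> x, which is coercive.\<close>

lemma interior_subset_range_mixed_mean: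
  "interior (minkowski_comb lam newton_polytope) \<subseteq> range mixed_mean"
proof
  let ?K = "minkowski_comb lam newton_polytope"
  fix y assume "y \<in> interior ?K"
  then obtain e where e: "e > 0" "cball y e \<subseteq> ?K"
    by (auto simp: mem_interior_cball)
  define L where "L = (\<lambda>i x. ln (expsum A (c i) x))"
  define \<phi> where "\<phi> = (\<lambda>x. (\<Sum>i\<in>UNIV. lam i * L i x) - y \<bullet> x)"
  have fin: "finite A" using ws[of undefined] by (simp add: weight_system_def)
  define B where "B = Max ((\<lambda>(i, s). \<bar>ln (c i s)\<bar>) ` (UNIV \<times> A))"
  have B: "- ln (c i s) \<le> B" if "s \<in> A" for i s
  proof -
    have "\<bar>ln (c i s)\<bar> \<le> B"
      unfolding B_def using fin that by (intro Max_ge) auto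
    then show ?thesis by linarith
  qed
  \<comment> \<open>A single summand bounds log-sum-exp from below at each exponent of the support;
    the bound defines a half-space, so it extends to the convex hull.\<close>
  have np: "q \<bullet> x \<le> L i x + B" if q: "q \<in> newton_polytope i" for q i x
  proof -
    have "newton_polytope i \<subseteq> {q. x \<bullet> q \<le> L i x + B}"
      unfolding newton_polytope_def
    proof (rule hull_minimal)
      show "{s \<in> A. c i s > 0} \<subseteq> {q. x \<bullet> q \<le> L i x + B}"
      proof clarify
        fix s assume s: "s \<in> A" "c i s > 0"
        have "ln (c i s) + s \<bullet> x = ln (c i s * exp (s \<bullet> x))" using s by (simp add: ln_mult)
        also have "\<dots> \<le> L i x"
          unfolding L_def using expsum_ge[OF ws s(1), of i x] s expsum_pos[OF ws, of i x] by (subst ln_le_cancel_iff) auto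
        finally show "x \<bullet> s \<le> L i x + B" using B[OF s(1), of i] by (simp add: inner_commute)
      qed
    qed (rule convex_halfspace_le)
    then show ?thesis using q by (auto simp: inner_commute)
  qed
  define b where "b = (\<Sum>i\<in>UNIV. lam i * B)"
  have K: "z \<bullet> x \<le> \<phi> x + y \<bullet> x + b" if zK: "z \<in> ?K" for z x
  proof -
    obtain q where q: "\<And>i. q i \<in> newton_polytope i" "z = (\<Sum>i\<in>UNIV. lam i *\<^sub>R q i)"
      using minkowski_combE[OF zK] by blast
    have "z \<bullet> x = (\<Sum>i\<in>UNIV. lam i * (q i \<bullet> x))" by (simp add: q inner_sum_left)
    also have "\<dots> \<le> (\<Sum>i\<in>UNIV. lam i * (L i x + B))"
      using np q(1) lam by (intro sum_mono mult_left_mono) (auto simp: less_imp_le)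
    finally show ?thesis by (simp add: \<phi>_def b_def distrib_left sum.distrib)
  qed
  \<comment> \<open>The bound \<open>K\<close> is applied to the point of \<open>cball y e\<close>
    that lies farthest in direction \<open>x\<close>.\<close>
  have coercive: "e * norm x \<le> \<phi> x + b" for x
  proof (cases "x = 0")
    case True
    have "y \<in> ?K" using e by auto
    then show ?thesis using K[of y x] True by simp
  next
    case False
    have "y + (e / norm x) *\<^sub>R x \<in> cball y e"
      using e False by (simp add: dist_norm)
    then have "(y + (e / norm x) *\<^sub>R x) \<bullet> x \<le> \<phi> x + y \<bullet> x + b" using e K by blast
    moreover have "(y + (e / norm x) *\<^sub>R x) \<bullet> x = y \<bullet> x + e * norm x"
      using False by (simp add: inner_add_left dot_square_norm power2_eq_square)
    ultimately show ?thesis by simp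
  qed
  have der: "(\<phi> has_derivative (\<lambda>v. (\<Sum>i\<in>UNIV. lam i * (gibbs_mean A (c i) x \<bullet> v)) - y \<bullet> v)) (at x)" for x
    unfolding \<phi>_def L_def
    by (intro has_derivative_diff has_derivative_sum has_derivative_mult_right has_derivative_ln_expsum[OF ws]
        bounded_linear_imp_has_derivative bounded_linear_inner_right)
  \<comment> \<open>Beyond radius \<open>R\<close> coercivity forces \<open>\<phi> x\<close> to be
    at least \<open>\<phi> 0\<close>, so a minimum over the ball is a global one.\<close>
  define R where "R = (\<bar>\<phi> 0\<bar> + \<bar>b\<bar>) / e"
  have R: "R \<ge> 0" using e by (simp add: R_def)
  have "continuous_on (cball 0 R) \<phi>"
    using der by (intro has_derivative_continuous_on) (rule has_derivative_at_withinI)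
  then obtain z where z: "\<And>x. norm x \<le> R \<Longrightarrow> \<phi> z \<le> \<phi> x"
    using continuous_attains_inf[of "cball 0 R" \<phi>] R unfolding Ball_def mem_cball_0
    by (metis cball_eq_empty compact_cball not_less)
  have min: "\<phi> z \<le> \<phi> x" for x
  proof (cases "norm x \<le> R")
    case False
    have "\<phi> z \<le> \<phi> 0" using z R by simp
    also have "\<dots> \<le> e * R - b" using e by (simp add: R_def)
    also have "\<dots> \<le> e * norm x - b" using False e by simp
    finally show ?thesis using coercive[of x] by simp
  qed (use z in simp)
  have "(\<lambda>v. (\<Sum>i\<in>UNIV. lam i * (gibbs_mean A (c i) z \<bullet> v)) - y \<bullet> v) = (\<lambda>v. 0)"
    using min by (intro differential_zero_maxmin[OF UNIV_I open_UNIV der]) auto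
  then have "(mixed_mean z - y) \<bullet> v = 0" for v
    by (auto simp: mixed_mean_def inner_sum_left inner_diff_left fun_eq_iff)
  then have "mixed_mean z = y" using inner_eq_zero_iff[of "mixed_mean z - y"] by simp
  then show "y \<in> range mixed_mean" by blast
qed

lemma matrix_mixed_mean_deriv: "matrix (mixed_mean_deriv x) *v v = mixed_mean_deriv x v"
  using has_derivative_linear[OF has_derivative_mixed_mean[of x]] by (simp add: matrix_vector_mul)

text \<open>A common flat direction lies in the kernel of the Jacobian. Each polytope then lies in a
  hyperplane orthogonal to \<open>v\<close>, and so does their Minkowski combination.\<close>

lemma mixed_mean_deriv_degenerate:
  assumes "v \<noteq> 0" "\<And>i. flat_direction A (c i) v"
  shows "det (matrix (mixed_mean_deriv x)) = 0"
    and "negligible (minkowski_comb lam newton_polytope)"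
proof -
  have "matrix (mixed_mean_deriv x) *v v = 0"
    unfolding matrix_mixed_mean_deriv using assms(2)
    by (simp add: mixed_mean_deriv_def gibbs_mean_deriv_flat[OF ws])
  then show "det (matrix (mixed_mean_deriv x)) = 0"
    using assms(1) det_eq_0_iff_kernel by blast
  have "\<exists>t. t \<in> A \<and> c i t > 0" for i
    using ws[of i] by (auto simp: weight_system_def)
  then obtain t where t: "\<And>i. t i \<in> A" "\<And>i. c i (t i) > 0" by metis
  have np: "newton_polytope i \<subseteq> {q. v \<bullet> q = v \<bullet> t i}" for i
    unfolding newton_polytope_def
  proof (rule hull_minimal)
    show "{s \<in> A. c i s > 0} \<subseteq> {q. v \<bullet> q = v \<bullet> t i}"
    proof clarify
      fix s assume "s \<in> A" "c i s > 0"
      then have "(s - t i) \<bullet> v = 0"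
        using assms(2)[of i] t[of i] by (simp add: flat_direction_def)
      then show "v \<bullet> s = v \<bullet> t i" by (simp add: inner_diff_left inner_commute[of v])
    qed
  qed (rule convex_hyperplane)
  have "minkowski_comb lam newton_polytope \<subseteq> {z. v \<bullet> z = (\<Sum>i\<in>UNIV. lam i * (v \<bullet> t i))}"
  proof
    fix z assume "z \<in> minkowski_comb lam newton_polytope"
    then obtain q where q: "\<And>i. q i \<in> newton_polytope i" "z = (\<Sum>i\<in>UNIV. lam i *\<^sub>R q i)"
      using minkowski_combE by blast
    have "v \<bullet> q i = v \<bullet> t i" for i using np q(1) by blast
    then show "z \<in> {z. v \<bullet> z = (\<Sum>i\<in>UNIV. lam i * (v \<bullet> t i))}" by (simp add: q(2) inner_sum_right)
  qed
  then show "negligible (minkowski_comb lam newton_polytope)"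
    using negligible_hyperplane[of v] assms(1) negligible_subset by blast
qed

text \<open>All summands are positive semidefinite and at least one is strictly positive in
  direction \<open>v\<close>. Hence the gradient map is strictly monotone along every segment, which
  gives injectivity.\<close>

lemma mixed_mean_deriv_nondegenerate:
  assumes nondeg: "\<And>v. v \<noteq> 0 \<Longrightarrow> \<exists>i. \<not> flat_direction A (c i) v"
  shows "v \<noteq> 0 \<Longrightarrow> mixed_mean_deriv x v \<bullet> v > 0"
    and "det (matrix (mixed_mean_deriv x)) > 0"
    and "inj mixed_mean"
proof -
  show pos: "mixed_mean_deriv x v \<bullet> v > 0" if v: "v \<noteq> 0" for x v
  proof -
    obtain j where j: "\<not> flat_direction A (c j) v" using nondeg[OF v] by blast
    have "0 < (\<Sum>i\<in>UNIV. lam i * (gibbs_mean_deriv A (c i) x v \<bullet> v))"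
      using lam j inner_gibbs_mean_deriv_pos[OF ws j] inner_gibbs_mean_deriv_nonneg[OF ws]
      by (intro sum_pos2[of UNIV j]) (auto simp: less_imp_le)
    then show ?thesis by (simp add: mixed_mean_deriv_def inner_sum_left)
  qed
  show "det (matrix (mixed_mean_deriv x)) > 0"
    by (rule det_pos_if_positive_definite) (simp add: matrix_mixed_mean_deriv pos)
  show "inj mixed_mean"
  proof (rule injI, rule ccontr)
    fix x y assume eq: "mixed_mean x = mixed_mean y" and ne: "x \<noteq> y"
    define v where "v = y - x"
    have v: "v \<noteq> 0" using ne by (simp add: v_def)
    define f where "f = (\<lambda>t. mixed_mean (x + t *\<^sub>R v) \<bullet> v)"
    have f': "(f has_real_derivative mixed_mean_deriv (x + t *\<^sub>R v) v \<bullet> v) (at t)" for t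
    proof -
      have "((\<lambda>t. x + t *\<^sub>R v) has_derivative (\<lambda>h. h *\<^sub>R v)) (at t)"
        by (auto intro!: derivative_eq_intros)
      from has_derivative_compose[OF this has_derivative_mixed_mean]
      have "((\<lambda>t. mixed_mean (x + t *\<^sub>R v)) has_derivative (\<lambda>h. mixed_mean_deriv (x + t *\<^sub>R v) (h *\<^sub>R v))) (at t)" .
      then have "(f has_derivative (\<lambda>h. mixed_mean_deriv (x + t *\<^sub>R v) (h *\<^sub>R v) \<bullet> v)) (at t)"
        unfolding f_def by (rule has_derivative_inner_left)
      moreover have "mixed_mean_deriv (x + t *\<^sub>R v) (h *\<^sub>R v) = h *\<^sub>R mixed_mean_deriv (x + t *\<^sub>R v) v" for h
        using has_derivative_linear[OF has_derivative_mixed_mean] by (simp add: linear_cmul)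
      ultimately show ?thesis
        by (simp add: has_field_derivative_def mult_commute_abs)
    qed
    have "f 0 < f 1"
      by (rule DERIV_pos_imp_increasing) (simp, use f' pos[OF v] in blast)
    then show False using eq by (simp add: f_def v_def)
  qed
qed

end

end

section \<open>Expansion of the Jacobian determinant and decay of its terms\<close>

text \<open>F chooses a set index i and a pair (a, b) for every row k of the Jacobian matrix.\<close>

definition mixed_term ::
  "(real^'m) set \<Rightarrow> ('n \<Rightarrow> real^'m \<Rightarrow> real) \<Rightarrow> ('m \<Rightarrow> 'n \<times> (real^'m) \<times> (real^'m)) \<Rightarrow> real^'m \<Rightarrow> real"
where
  "mixed_term A c F x =
     (\<Prod>k\<in>UNIV. case F k of (i, a, b) \<Rightarrow> gibbs A (c i) x a * gibbs A (c i) x b * a $ k)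
     * det (\<chi> k. case F k of (i, a, b) \<Rightarrow> a - b)"

text \<open>Row \<open>k\<close> of the Jacobian is a sum over triples \<open>(i, a, b)\<close> of
  multiples of \<open>a - b\<close> with coefficient containing \<open>a $ k\<close>; multilinearity
  then yields one term for each choice \<open>F\<close> of triples.\<close>

lemma det_mixed_mean_deriv:
  fixes A :: "(real^'m) set" and c :: "'n::finite \<Rightarrow> real^'m \<Rightarrow> real"
  assumes ws: "\<And>i. weight_system A (c i)" and lam: "\<And>i. lam i > 0"
  shows "det (matrix (mixed_mean_deriv A c lam x)) =
    (\<Sum>F\<in>UNIV \<rightarrow>\<^sub>E UNIV \<times> A \<times> A. (\<Prod>k\<in>UNIV. lam (fst (F k))) * mixed_term A c F x)"
proof -
  have fin: "finite A" using ws[of undefined] by (simp add: weight_system_def)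
  define r where "r = (\<lambda>k (i, a, b). (lam i * (gibbs A (c i) x a * gibbs A (c i) x b * a $ k)) *s (a - b))"
  have "matrix (mixed_mean_deriv A c lam x) = (\<chi> k. \<Sum>j\<in>UNIV \<times> A \<times> A. r k j)"
    by (simp add: matrix_def mixed_mean_deriv_def gibbs_mean_deriv_def r_def vec_eq_iff inner_axis
        sum.cartesian_product[symmetric] sum_distrib_left algebra_simps)
  then have "det (matrix (mixed_mean_deriv A c lam x)) = (\<Sum>F\<in>UNIV \<rightarrow>\<^sub>E UNIV \<times> A \<times> A. det (\<chi> k. r k (F k)))"
    using fin by (simp add: det_sum_rows)
  moreover have "det (\<chi> k. r k (F k)) = (\<Prod>k\<in>UNIV. lam (fst (F k))) * mixed_term A c F x" for F
  proof -
    have "(\<chi> k. r k (F k)) = (\<chi> k. (lam (fst (F k)) * (case F k of (i, a, b) \<Rightarrow> gibbs A (c i) x a * gibbs A (c i) x b * a $ k))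
        *s (case F k of (i, a, b) \<Rightarrow> a - b))"
      by (simp add: r_def vec_eq_iff right_diff_distrib split: prod.split)
    then show ?thesis
      by (simp add: det_rows_mul mixed_term_def prod.distrib)
  qed
  ultimately show ?thesis by simp
qed

lemma continuous_on_mixed_term:
  assumes "\<And>i. weight_system A (c i)"
  shows "continuous_on X (mixed_term A c F)"
  unfolding mixed_term_def[abs_def] case_prod_beta
  by (intro continuous_intros continuous_on_gibbs assms)

lemma mixed_term_eq_0:
  assumes "F k = (i, a, b)" "c i a = 0 \<or> c i b = 0"
  shows "mixed_term A c F x = 0"
proof -
  have "(\<Prod>k\<in>UNIV. case F k of (i, a, b) \<Rightarrow> gibbs A (c i) x a * gibbs A (c i) x b * a $ k) = 0"
    using assms by (intro prod_zero) (auto intro!: exI[of _ k] simp: gibbs_def)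
  then show ?thesis by (simp add: mixed_term_def)
qed

text \<open>All Gibbs weights lie between 0 and 1, so every one except that of \<open>s\<close> in
  row \<open>k\<close> may be dropped.\<close>

lemma abs_mixed_term_le:
  fixes F :: "'m::finite \<Rightarrow> 'n \<times> (real^'m) \<times> (real^'m)"
  assumes ws: "\<And>i. weight_system A (c i)" and F: "F \<in> UNIV \<rightarrow>\<^sub>E UNIV \<times> A \<times> A"
    and k: "F k = (i, a, b)" and s: "s \<in> {a, b}"
  shows "\<bar>mixed_term A c F x\<bar> \<le>
    (\<Prod>k\<in>UNIV. \<bar>fst (snd (F k)) $ k\<bar>) * \<bar>det (\<chi> k. case F k of (i, a, b) \<Rightarrow> a - b)\<bar> * gibbs A (c i) x s"
proof -
  define g where "g = (\<lambda>j. case F j of (i, a, b) \<Rightarrow> gibbs A (c i) x a * gibbs A (c i) x b)"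
  have g01: "0 \<le> g j" "g j \<le> 1" for j
  proof -
    obtain i' a' b' where Fj: "F j = (i', a', b')" by (metis prod_cases3)
    then have "a' \<in> A" "b' \<in> A" using F PiE_mem[OF F, of j] by auto
    then show "0 \<le> g j" "g j \<le> 1"
      using gibbs_nonneg[OF ws, of _ i' x] gibbs_le_1[OF ws, of _ i' x] by (auto simp: g_def Fj intro: mult_le_one)
  qed
  have ab: "a \<in> A" "b \<in> A" using PiE_mem[OF F, of k] k by auto
  have "prod g UNIV = g k * prod g (UNIV - {k})" by (simp add: prod.remove)
  also have "\<dots> \<le> g k * 1"
    using g01 by (intro mult_left_mono prod_le_1) auto
  also have "g k * 1 \<le> gibbs A (c i) x s"
    using ab s gibbs_nonneg[OF ws, of _ i x] gibbs_le_1[OF ws, of _ i x]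
    by (auto simp: g_def k intro: mult_left_le mult_left_le_one_le)
  finally have le: "prod g UNIV \<le> gibbs A (c i) x s" .
  have "(\<Prod>k\<in>UNIV. case F k of (i, a, b) \<Rightarrow> gibbs A (c i) x a * gibbs A (c i) x b * a $ k) =
      (\<Prod>k\<in>UNIV. g k * fst (snd (F k)) $ k)"
    by (intro prod.cong) (auto simp: g_def split: prod.split)
  then have "\<bar>mixed_term A c F x\<bar> =
      (\<Prod>k\<in>UNIV. \<bar>fst (snd (F k)) $ k\<bar>) * \<bar>det (\<chi> k. case F k of (i, a, b) \<Rightarrow> a - b)\<bar> * prod g UNIV"
    using g01 by (simp add: mixed_term_def prod.distrib abs_mult abs_prod prod_nonneg)
  then show ?thesis
    using le by (simp add: mult_left_mono prod_nonneg)
qed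

text \<open>In a direction x with (u - s) \<bullet> x > 0 the Gibbs weight of s is exponentially small compared
  with that of u, uniformly over all weights c that are controlled by C.\<close>

lemma mixed_term_dominator:
  fixes F :: "'m::finite \<Rightarrow> 'n \<times> (real^'m) \<times> (real^'m)"
  assumes A: "finite A" and F: "F \<in> UNIV \<rightarrow>\<^sub>E UNIV \<times> A \<times> A" and U: "\<And>i. U i \<subseteq> A" and "C \<ge> 0"
    and ray: "\<And>x. x \<noteq> 0 \<Longrightarrow> \<exists>k i a b s u. F k = (i, a, b) \<and> s \<in> {a, b} \<and> u \<in> U i \<and> 0 < (u - s) \<bullet> x"
  obtains h where "h integrable_on UNIV"
    "\<And>c x. \<lbrakk>\<And>i. weight_system A (c i); \<And>i s u. \<lbrakk>s \<in> A; u \<in> U i\<rbrakk> \<Longrightarrow> c i s \<le> C * c i u \<and> c i u > 0\<rbrakk>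
       \<Longrightarrow> \<bar>mixed_term A c F x\<bar> \<le> h x"
proof -
  \<comment> \<open>These differences depend only on \<open>F\<close> and \<open>U\<close>, not on
    the weights, so one dominating function serves all admissible \<open>c\<close>.\<close>
  define D where "D = {u - s | u s. \<exists>k i a b. F k = (i, a, b) \<and> s \<in> {a, b} \<and> u \<in> U i}"
  define M where "M = (\<Prod>k\<in>UNIV. \<bar>fst (snd (F k)) $ k\<bar>) * \<bar>det (\<chi> k. case F k of (i, a, b) \<Rightarrow> a - b)\<bar>"
  have M: "M \<ge> 0" by (simp add: M_def prod_nonneg)
  have "D \<subseteq> (\<lambda>(u, s). u - s) ` (A \<times> A)"
  proof
    fix d assume "d \<in> D"
    then obtain u s k i a b where *: "d = u - s" "F k = (i, a, b)" "s \<in> {a, b}" "u \<in> U i"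
      by (auto simp: D_def)
    moreover have "a \<in> A" "b \<in> A" using PiE_mem[OF F, of k] *(2) by auto
    ultimately show "d \<in> (\<lambda>(u, s). u - s) ` (A \<times> A)" using U[of i] by auto
  qed
  then have D: "finite D" using A by (meson finite_SigmaI finite_imageI finite_subset)
  have Dpos: "\<exists>d\<in>D. 0 < d \<bullet> x" if "x \<noteq> 0" for x
    using ray[OF that] unfolding D_def by blast
  obtain h :: "real^'m \<Rightarrow> real" where h: "h integrable_on UNIV"
    "\<And>x y. (\<And>d. d \<in> D \<Longrightarrow> y \<le> (M * C) * exp (- (d \<bullet> x))) \<Longrightarrow> y \<le> h x"
    using integrable_exp_dominator[OF D Dpos, of "M * C"] M \<open>C \<ge> 0\<close> by auto
  show thesis
  proof (rule that[OF h(1) h(2)])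
    fix c x d
    assume ws: "\<And>i. weight_system A (c i)"
      and cC: "\<And>i s u. \<lbrakk>s \<in> A; u \<in> U i\<rbrakk> \<Longrightarrow> c i s \<le> C * c i u \<and> c i u > 0" and d: "d \<in> D"
    obtain u s k i a b where *: "d = u - s" "F k = (i, a, b)" "s \<in> {a, b}" "u \<in> U i"
      using d by (auto simp: D_def)
    have sA: "s \<in> A" using PiE_mem[OF F, of k] *(2,3) by auto
    have "\<bar>mixed_term A c F x\<bar> \<le> M * gibbs A (c i) x s"
      unfolding M_def by (rule abs_mixed_term_le[where k = k, OF ws F *(2,3)])
    also have "\<dots> \<le> M * (C * exp (- ((u - s) \<bullet> x)))"
      using *(4) U sA cC M by (intro mult_left_mono gibbs_le_exp[OF ws]) auto
    finally show "\<bar>mixed_term A c F x\<bar> \<le> M * C * exp (- (d \<bullet> x))" by (simp add: *(1))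
  qed
qed

lemma ex_nonorthogonal_if_det_nz:
  fixes d :: "'m::finite \<Rightarrow> real^'m"
  assumes "det (\<chi> k. d k) \<noteq> 0" "x \<noteq> 0"
  obtains k where "d k \<bullet> x \<noteq> 0"
proof -
  have "(\<chi> k. d k) *v x \<noteq> 0" using assms det_eq_0_iff_kernel by blast
  then show thesis using that by (auto simp: vec_eq_iff matrix_vector_mul_component)
qed

text \<open>If the term is not identically zero, all chosen exponents have positive weight and the
  determinant is nonzero. In each direction some pair \<open>a\<close>, \<open>b\<close> is then
  separated, and its higher point dominates its lower one.\<close>

lemma integrable_mixed_term:
  fixes F :: "'m::finite \<Rightarrow> 'n::finite \<times> (real^'m) \<times> (real^'m)"
  assumes ws: "\<And>i. weight_system A (c i)" and F: "F \<in> UNIV \<rightarrow>\<^sub>E UNIV \<times> A \<times> A"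
  shows "mixed_term A c F integrable_on UNIV"
proof (cases "(\<exists>x. mixed_term A c F x \<noteq> 0)")
  case True
  then have nz: "c i a \<noteq> 0 \<and> c i b \<noteq> 0" if "F k = (i, a, b)" for k i a b
    using mixed_term_eq_0[of F k i a b c A] that True by blast
  have dnz: "det (\<chi> k. case F k of (i, a, b) \<Rightarrow> a - b) \<noteq> 0"
    using True by (auto simp: mixed_term_def)
  define U where "U = (\<lambda>i. {s \<in> A. c i s > 0})"
  have A: "finite A" using ws[of undefined] by (simp add: weight_system_def)
  \<comment> \<open>The largest ratio of weights. Quotients by zero count as 0 and are harmless,
    since \<open>C\<close> is applied only to \<open>u\<close> of positive weight.\<close>
  define C where "C = Max ((\<lambda>(i, s, u). \<bar>c i s / c i u\<bar>) ` (UNIV \<times> A \<times> A))"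
  have C: "\<bar>c i s / c i u\<bar> \<le> C" if "s \<in> A" "u \<in> A" for i s u
    unfolding C_def using A that by (intro Max_ge image_eqI[of _ _ "(i, s, u)"]) auto
  have mem: "a \<in> U i \<and> b \<in> U i" if "F k = (i, a, b)" for k i a b
    using nz[OF that] PiE_mem[OF F, of k] that ws[of i] by (force simp: U_def weight_system_def)
  have ray: "\<exists>k i a b s u. F k = (i, a, b) \<and> s \<in> {a, b} \<and> u \<in> U i \<and> 0 < (u - s) \<bullet> x" if "x \<noteq> 0" for x
  proof -
    obtain k where k: "(case F k of (i, a, b) \<Rightarrow> a - b) \<bullet> x \<noteq> 0"
      using ex_nonorthogonal_if_det_nz[OF dnz \<open>x \<noteq> 0\<close>] .
    obtain i a b where Fk: "F k = (i, a, b)" by (metis prod_cases3)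
    have "(a - b) \<bullet> x > 0 \<or> (b - a) \<bullet> x > 0" using k Fk by (auto simp: inner_diff_left)
    then show ?thesis using mem[OF Fk] Fk by blast
  qed
  obtain s where "s \<in> A" using ws[of undefined] by (auto simp: weight_system_def)
  then have "C \<ge> 0" using C[of s s undefined] by linarith
  moreover have "\<And>i. U i \<subseteq> A" by (auto simp: U_def)
  ultimately obtain h where h: "h integrable_on UNIV"
    "\<And>c' x. \<lbrakk>\<And>i. weight_system A (c' i); \<And>i s u. \<lbrakk>s \<in> A; u \<in> U i\<rbrakk> \<Longrightarrow> c' i s \<le> C * c' i u \<and> c' i u > 0\<rbrakk>
       \<Longrightarrow> \<bar>mixed_term A c' F x\<bar> \<le> h x"
    using mixed_term_dominator[OF A F _ _ ray] by blast
  have "\<bar>mixed_term A c F x\<bar> \<le> h x" for x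
  proof (rule h(2)[OF ws])
    fix i s u assume su: "s \<in> A" "u \<in> U i"
    have u: "u \<in> A" "c i u > 0" using su by (auto simp: U_def)
    have "c i s / c i u \<le> C" using C[OF su(1) u(1), of i] by linarith
    then show "c i s \<le> C * c i u \<and> c i u > 0" using u by (simp add: field_simps)
  qed
  then show ?thesis
    using continuous_on_mixed_term[where X = UNIV and F = F, OF ws]
    by (intro measurable_bounded_by_integrable_imp_integrable[OF _ h(1)])
      (auto intro: continuous_imp_measurable_on_sets_lebesgue)
next
  case False
  then have "mixed_term A c F = (\<lambda>_. 0)" by auto
  then show ?thesis using integrable_0 by simp
qed

text \<open>Change of variables along the injective gradient map, followed by termwise integration
  of its Jacobian determinant. In the degenerate case both sides vanish.\<close>

lemma vol_minkowski_comb_eq_mixed_terms: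
  fixes A :: "(real^'m::{finite,wellorder}) set" and c :: "'n::finite \<Rightarrow> real^'m::{finite,wellorder} \<Rightarrow> real"
  assumes ws: "\<And>i. weight_system A (c i)" and lam: "\<And>i. lam i > 0"
  shows "vol (minkowski_comb lam (\<lambda>i. convex hull {s \<in> A. c i s > 0})) =
    (\<Sum>F\<in>UNIV \<rightarrow>\<^sub>E UNIV \<times> A \<times> A. integral UNIV (mixed_term A c F) * (\<Prod>k\<in>UNIV. lam (fst (F k))))"
proof -
  let ?\<Phi> = "(UNIV :: 'm set) \<rightarrow>\<^sub>E (UNIV :: 'n set) \<times> A \<times> A"
  let ?K = "minkowski_comb lam (newton_polytope A c)"
  let ?G = "mixed_mean A c lam" and ?G' = "mixed_mean_deriv A c lam"
  have A: "finite A" using ws[of undefined] by (simp add: weight_system_def)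
  have hi: "((\<lambda>x. det (matrix (?G' x))) has_integral
      (\<Sum>F\<in>?\<Phi>. (\<Prod>k\<in>UNIV. lam (fst (F k))) * integral UNIV (mixed_term A c F))) UNIV"
    unfolding det_mixed_mean_deriv[OF ws lam] using A
    by (intro has_integral_sum has_integral_mult_right integrable_integral integrable_mixed_term ws finite_PiE) auto
  have "vol ?K = integral UNIV (\<lambda>x. det (matrix (?G' x)))"
  proof (cases "\<exists>v. v \<noteq> 0 \<and> (\<forall>i. flat_direction A (c i) v)")
    case True
    then obtain v where v: "v \<noteq> 0" "\<And>i. flat_direction A (c i) v" by blast
    show ?thesis
      using negligible_imp_measure0[OF mixed_mean_deriv_degenerate(2)[where c = c and lam = lam, OF ws lam v]]
      by (simp add: mixed_mean_deriv_degenerate(1)[where c = c and lam = lam, OF ws lam v])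
  next
    case False
    then have nondeg: "\<And>v. v \<noteq> 0 \<Longrightarrow> \<exists>i. \<not> flat_direction A (c i) v" by blast
    have det: "\<bar>det (matrix (?G' x))\<bar> = det (matrix (?G' x))" for x
      using mixed_mean_deriv_nondegenerate(2)[where c = c and lam = lam and x = x, OF ws lam nondeg] by simp
    have der: "(?G has_derivative ?G' x) (at x within UNIV)" for x
      using has_derivative_mixed_mean[where c = c and lam = lam, OF ws lam] by simp
    have inj: "inj ?G" by (rule mixed_mean_deriv_nondegenerate(3)[where c = c and lam = lam, OF ws lam nondeg])
    have int: "(\<lambda>x. \<bar>det (matrix (?G' x))\<bar>) integrable_on UNIV"
      unfolding det using hi by blast
    have range: "range ?G \<in> lmeasurable"
      using measurable_differentiable_image_eq[OF _ der inj] int by auto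
    have "convex ?K"
      by (rule convex_minkowski_comb) (simp add: newton_polytope_def)
    \<comment> \<open>The image lies between the interior and the whole of \<open>?K\<close>, so the
      two differ only within the frontier, which is null by convexity.\<close>
    then have "negligible (frontier ?K)" by (rule negligible_convex_frontier)
    moreover have "range ?G - ?K \<union> (?K - range ?G) \<subseteq> frontier ?K"
      using range_mixed_mean_subset[where c = c and lam = lam, OF ws lam] interior_subset_range_mixed_mean[where c = c and lam = lam, OF ws lam] closure_subset[of ?K]
      unfolding frontier_def by blast
    ultimately have "vol ?K = vol (range ?G)"
      using range by (meson measure_negligible_symdiff negligible_subset)
    then show ?thesis
      using measure_differentiable_image_eq[OF _ der inj int] by (simp add: det)
  qed
  moreover have "newton_polytope A c = (\<lambda>i. convex hull {s \<in> A. c i s > 0})"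
    by (simp add: fun_eq_iff newton_polytope_def)
  ultimately show ?thesis
    using integral_unique[OF hi] by (simp add: mult.commute)
qed

section \<open>Well-ordered coordinate indices\<close>

text \<open>The change of variables theorem of the library requires the index type of the
  coordinates to be well-ordered, so the coordinates are renumbered.\<close>

typedef (overloaded) ('n::finite) ord_index = "{..<CARD('n)}"
  by (rule exI[of _ 0]) simp

instance ord_index :: (finite) finite
proof
  have "(UNIV :: 'a ord_index set) = Abs_ord_index ` {..<CARD('a)}"
    by (metis Abs_ord_index_cases UNIV_eq_I imageI)
  then show "finite (UNIV :: 'a ord_index set)" by (metis finite_imageI finite_lessThan)
qed

instantiation ord_index :: (finite) wellorder
begin

definition "x \<le> y \<longleftrightarrow> Rep_ord_index x \<le> Rep_ord_index y"
definition "x < y \<longleftrightarrow> Rep_ord_index x < Rep_ord_index y"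

instance
proof
  fix P :: "'a ord_index \<Rightarrow> bool" and a
  assume step: "\<And>x. (\<And>y. y < x \<Longrightarrow> P y) \<Longrightarrow> P x"
  show "P a"
    by (induction a rule: measure_induct_rule[of Rep_ord_index]) (use step in \<open>auto simp: less_ord_index_def\<close>)
qed (auto simp: less_eq_ord_index_def less_ord_index_def Rep_ord_index_inject)

end

lemma card_ord_index: "CARD('n::finite ord_index) = CARD('n)"
  using type_definition.card[OF type_definition_ord_index[where 'n = 'n]] by simp

section \<open>Invariance of volume under renumbering of coordinates\<close>

lemma prod_Basis_cart:
  fixes x :: "real^'k"
  shows "(\<Prod>b\<in>Basis. x \<bullet> b) = (\<Prod>i\<in>UNIV. x $ i)"
proof -
  have B: "(Basis :: (real^'k) set) = (\<lambda>i. axis i 1) ` UNIV"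
    by (auto simp: Basis_vec_def)
  have inj: "inj (\<lambda>i. axis i 1 :: real^'k)" by (auto simp: inj_on_def axis_eq_axis)
  show ?thesis unfolding B by (subst prod.reindex[OF inj]) (simp add: inner_axis)
qed

definition reindex :: "('m \<Rightarrow> 'n) \<Rightarrow> real^'n \<Rightarrow> real^'m" where
  "reindex \<sigma> x = (\<chi> k. x $ \<sigma> k)"

context
  fixes \<sigma> :: "'m::finite \<Rightarrow> 'n::finite"
  assumes \<sigma>: "bij \<sigma>"
begin

lemma linear_reindex: "linear (reindex \<sigma>)"
  by (rule linearI) (simp_all add: reindex_def vec_eq_iff)

lemma reindex_inverse:
  "reindex (inv \<sigma>) (reindex \<sigma> x) = x" "reindex \<sigma> (reindex (inv \<sigma>) y) = y"
  using \<sigma> by (simp_all add: reindex_def vec_eq_iff bij_is_inj bij_is_surj surj_f_inv_f)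

lemma bij_reindex: "bij (reindex \<sigma>)"
  using reindex_inverse by (intro o_bij[of "reindex (inv \<sigma>)"]) (auto simp: fun_eq_iff)

lemma inner_reindex: "reindex \<sigma> x \<bullet> reindex \<sigma> y = x \<bullet> y"
  using sum.reindex_bij_betw[OF \<sigma>, of "\<lambda>j. x $ j * y $ j"] by (simp add: inner_vec_def reindex_def)

text \<open>Preimages of boxes are boxes with the same side lengths in another order, and the
  measure is determined by its values on boxes.\<close>

lemma lborel_distr_reindex: "lborel = distr lborel borel (reindex \<sigma>)"
proof (rule lborel_eqI)
  have [measurable]: "reindex \<sigma> \<in> borel \<rightarrow>\<^sub>M borel"
    using linear_reindex by (intro borel_measurable_continuous_onI linear_continuous_on) (simp add: linear_conv_bounded_linear)
  fix l u :: "real^'m" assume le: "\<And>b. b \<in> Basis \<Longrightarrow> l \<bullet> b \<le> u \<bullet> b"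
  have le': "l $ k \<le> u $ k" for k
    using le[of "axis k 1"] by (simp add: inner_axis axis_in_Basis_iff)
  let ?S = "reindex (inv \<sigma>)"
  have "x \<in> box (?S l) (?S u) \<longleftrightarrow> reindex \<sigma> x \<in> box l u" for x
  proof -
    have "x \<in> box (?S l) (?S u) \<longleftrightarrow> (\<forall>j. l $ inv \<sigma> j < x $ j \<and> x $ j < u $ inv \<sigma> j)"
      by (simp add: mem_box_cart reindex_def)
    also have "\<dots> \<longleftrightarrow> (\<forall>k. l $ inv \<sigma> (\<sigma> k) < x $ \<sigma> k \<and> x $ \<sigma> k < u $ inv \<sigma> (\<sigma> k))"
      using \<sigma> by (metis bij_inv_eq_iff)
    also have "\<dots> \<longleftrightarrow> reindex \<sigma> x \<in> box l u"
      using \<sigma> by (simp add: mem_box_cart reindex_def bij_is_inj)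
    finally show ?thesis .
  qed
  then have "reindex \<sigma> -` box l u = box (?S l) (?S u)" by auto
  then have "emeasure (distr lborel borel (reindex \<sigma>)) (box l u) = emeasure lborel (box (?S l) (?S u))"
    by (simp add: emeasure_distr)
  also have "\<dots> = (\<Prod>b\<in>Basis. (?S u - ?S l) \<bullet> b)"
    using le' by (intro emeasure_lborel_box) (auto simp: Basis_vec_def inner_axis reindex_def)
  also have "(\<Prod>b\<in>Basis. (?S u - ?S l) \<bullet> b) = (\<Prod>j\<in>UNIV. u $ inv \<sigma> j - l $ inv \<sigma> j)"
    by (simp add: prod_Basis_cart reindex_def)
  also have "\<dots> = (\<Prod>k\<in>UNIV. u $ k - l $ k)"
    using prod.reindex_bij_betw[OF bij_imp_bij_inv[OF \<sigma>], of "\<lambda>k. u $ k - l $ k"] by simp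
  also have "\<dots> = (\<Prod>b\<in>Basis. (u - l) \<bullet> b)"
    by (simp add: prod_Basis_cart)
  finally show "emeasure (distr lborel borel (reindex \<sigma>)) (box l u) = (\<Prod>b\<in>Basis. (u - l) \<bullet> b)" .
qed simp

lemma vol_reindex_convex:
  assumes "convex S"
  shows "vol (reindex \<sigma> ` S) = vol S"
proof -
  let ?R = "reindex \<sigma>"
  have [measurable]: "?R \<in> borel \<rightarrow>\<^sub>M borel"
    using linear_reindex by (intro borel_measurable_continuous_onI linear_continuous_on) (simp add: linear_conv_bounded_linear)
  have d: "distr lebesgue lborel ?R = lborel"
    using lborel_distr_reindex by (simp add: distr_completion cong: distr_cong)
  have leb: "lebesgue = distr lebesgue lebesgue ?R"
    using completion.completion_distr_eq[of ?R lborel lborel] by (simp add: d measurable_completion)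
  have m: "?R \<in> lebesgue \<rightarrow>\<^sub>M lebesgue"
    by (simp add: completion.measurable_completion2 d measurable_completion)
  let ?T = "?R ` S"
  have conv: "convex ?T" using assms linear_reindex by (rule convex_linear_image[rotated])
  \<comment> \<open>Convexity provides Lebesgue measurability: an open set together with part of a
    null frontier.\<close>
  have "?T = interior ?T \<union> ?T \<inter> frontier ?T"
    using interior_subset[of ?T] closure_subset[of ?T] unfolding frontier_def by blast
  moreover have "?T \<inter> frontier ?T \<in> sets lebesgue"
    using negligible_convex_frontier[OF conv] by (meson inf_le2 negligible_imp_sets negligible_subset)
  ultimately have T: "?T \<in> sets lebesgue"
    by (metis lborelD open_interior borel_open sets.Un sets_completionI_sets)
  have "vol ?T = measure (distr lebesgue lebesgue ?R) ?T" using leb by simp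
  also have "\<dots> = vol (?R -` ?T \<inter> space lebesgue)" using m T by (rule measure_distr)
  also have "?R -` ?T \<inter> space lebesgue = S" using bij_reindex by (simp add: inj_vimage_image_eq bij_is_inj)
  finally show ?thesis .
qed

lemma reindex_minkowski_comb:
  "reindex \<sigma> ` minkowski_comb lam Q = minkowski_comb lam (\<lambda>i. reindex \<sigma> ` Q i)"
proof (intro equalityI subsetI)
  fix z assume "z \<in> reindex \<sigma> ` minkowski_comb lam Q"
  then obtain q where q: "\<And>i. q i \<in> Q i" "z = reindex \<sigma> (\<Sum>i\<in>UNIV. lam i *\<^sub>R q i)"
    by (auto simp: minkowski_comb_def)
  have "z = (\<Sum>i\<in>UNIV. lam i *\<^sub>R reindex \<sigma> (q i))"
    by (simp add: q linear_sum[OF linear_reindex] linear_cmul[OF linear_reindex])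
  then show "z \<in> minkowski_comb lam (\<lambda>i. reindex \<sigma> ` Q i)"
    using q(1) by (auto intro: minkowski_combI)
next
  fix z assume "z \<in> minkowski_comb lam (\<lambda>i. reindex \<sigma> ` Q i)"
  then obtain p where p: "\<And>i. p i \<in> reindex \<sigma> ` Q i" "z = (\<Sum>i\<in>UNIV. lam i *\<^sub>R p i)"
    by (auto simp: minkowski_comb_def)
  then have "\<forall>i. \<exists>q. q \<in> Q i \<and> p i = reindex \<sigma> q" by blast
  then obtain q where q: "\<And>i. q i \<in> Q i" "\<And>i. p i = reindex \<sigma> (q i)" by metis
  have "z = reindex \<sigma> (\<Sum>i\<in>UNIV. lam i *\<^sub>R q i)"
    by (simp add: p(2) q(2) linear_sum[OF linear_reindex] linear_cmul[OF linear_reindex])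
  then show "z \<in> reindex \<sigma> ` minkowski_comb lam Q"
    using q(1) by (auto intro: minkowski_combI)
qed

end

section \<open>Faces\<close>

text \<open>Faces of a polytope are exposed, so a facet is cut out by a supporting half-space.
  \<open>face_dir\<close> uses minima, hence the direction \<open>- a\<close>.\<close>

lemma is_face_of_facet:
  fixes P :: "(real^'n) set"
  assumes "polytope P" "F facet_of P"
  shows "is_face F P"
proof -
  have F: "F face_of P" "F \<noteq> {}" "F \<noteq> P" using assms(2) by (auto simp: facet_of_def)
  have "F exposed_face_of P"
    using F(1) exposed_face_of_polyhedron[OF polytope_imp_polyhedron[OF assms(1)]] by blast
  then obtain a b where ab: "P \<subseteq> {x. a \<bullet> x \<le> b}" "F = P \<inter> {x. a \<bullet> x = b}"
    by (auto simp: exposed_face_of_def)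
  have "a \<noteq> 0" using F ab by auto
  obtain f where f: "f \<in> P" "a \<bullet> f = b" using F(2) ab(2) by blast
  have "h_dir P (- a) = - b"
    unfolding h_dir_def
  proof (rule cInf_eq_minimum)
    show "- b \<in> (\<lambda>q. q \<bullet> - a) ` P" using f by (auto simp: inner_commute intro!: image_eqI[of _ _ f])
  qed (use ab(1) in \<open>auto simp: inner_commute\<close>)
  then have "F = face_dir P (- a)"
    unfolding face_dir_def ab(2) by (auto simp: inner_commute)
  then show ?thesis using \<open>a \<noteq> 0\<close> unfolding is_face_def by (intro exI[of _ "- a"]) auto
qed

text \<open>Ensures that the weights at t = 0 are still weight systems. In dimension at least 2 a
  facet is positive dimensional and meets \<open>S i\<close>; in dimension 1 there is only one
  index, so \<open>S i\<close> is the whole union.\<close>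

lemma nonempty_if_meets_proper_faces:
  fixes S :: "'n::finite \<Rightarrow> (real^'n) set"
  assumes fin: "\<And>i. finite (S i)"
    and faces: "\<And>F i. is_face F (convex hull (\<Union>k. S k)) \<Longrightarrow>
                  F \<noteq> convex hull (\<Union>k. S k) \<Longrightarrow> aff_dim F > 0 \<Longrightarrow> F \<inter> S i \<noteq> {}"
    and int: "interior (convex hull (\<Union>k. S k)) \<noteq> {}"
  shows "S i \<noteq> {}"
proof (cases "CARD('n) = 1")
  case True
  then have "UNIV = {i}" by (metis UNIV_I card_1_singletonE singletonD)
  then have "(\<Union>k. S k) = S i" by (metis UN_singleton image_empty image_insert ccpo_Sup_singleton)
  then show ?thesis using int by auto
next
  case False
  let ?P = "convex hull (\<Union>k. S k)"
  have dim: "aff_dim ?P = CARD('n)" using aff_dim_nonempty_interior[OF int] by simp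
  have "polytope ?P" using fin by (intro polytope_convex_hull) auto
  moreover obtain F where F: "F facet_of ?P"
    using polytope_facet_exists[OF \<open>polytope ?P\<close>] dim by auto
  ultimately have "is_face F ?P" by (rule is_face_of_facet)
  moreover have "aff_dim F = CARD('n) - 1" using F dim by (simp add: facet_of_def)
  moreover have "CARD('n) > 1" using False by (simp add: Suc_lessI)
  moreover have "F \<noteq> ?P" using F by auto
  ultimately have "F \<inter> S i \<noteq> {}" by (intro faces) auto
  then show ?thesis by blast
qed

text \<open>The points of the hull that are maximal along \<open>x\<close> form a face, proper
  because the hull has interior. Either it is positive dimensional and meets every
  \<open>S i\<close>, or it is a single vertex \<open>v\<close>.\<close>

lemma maximiser_dichotomy:
  fixes S :: "'n::finite \<Rightarrow> (real^'n) set"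
  assumes fin: "\<And>i. finite (S i)"
    and faces: "\<And>F i. is_face F (convex hull (\<Union>k. S k)) \<Longrightarrow>
                  F \<noteq> convex hull (\<Union>k. S k) \<Longrightarrow> aff_dim F > 0 \<Longrightarrow> F \<inter> S i \<noteq> {}"
    and int: "interior (convex hull (\<Union>k. S k)) \<noteq> {}" and "x \<noteq> 0"
  shows "(\<forall>i. \<exists>u\<in>S i. \<forall>s\<in>(\<Union>k. S k). s \<bullet> x \<le> u \<bullet> x) \<or>
    (\<exists>v\<in>(\<Union>k. S k). \<forall>s\<in>(\<Union>k. S k). s \<noteq> v \<longrightarrow> s \<bullet> x < v \<bullet> x)"
proof -
  let ?A = "\<Union>k. S k"
  let ?P = "convex hull ?A"
  have A: "finite ?A" "?A \<noteq> {}" using fin int by auto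
  obtain v where v: "v \<in> ?A" "\<And>s. s \<in> ?A \<Longrightarrow> s \<bullet> x \<le> v \<bullet> x"
  proof -
    have "Max ((\<lambda>s. s \<bullet> x) ` ?A) \<in> (\<lambda>s. s \<bullet> x) ` ?A" using A by (intro Max_in) auto
    then obtain v where "Max ((\<lambda>s. s \<bullet> x) ` ?A) = v \<bullet> x" "v \<in> ?A" by (rule imageE)
    then show thesis using that[of v] A(1) Max_ge[of "(\<lambda>s. s \<bullet> x) ` ?A"] by (metis finite_imageI imageI)
  qed
  have P: "?P \<subseteq> {q. x \<bullet> q \<le> v \<bullet> x}"
    using v(2) by (intro hull_minimal convex_halfspace_le) (auto simp: inner_commute)
  have vP: "v \<in> ?P" using v(1) by (rule hull_inc)
  \<comment> \<open>Minima along \<open>- x\<close> are maxima along \<open>x\<close>.\<close>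
  define F where "F = face_dir ?P (- x)"
  have "h_dir ?P (- x) = - (v \<bullet> x)"
    unfolding h_dir_def
  proof (rule cInf_eq_minimum)
    show "- (v \<bullet> x) \<in> (\<lambda>q. q \<bullet> - x) ` ?P" using vP by (auto intro!: image_eqI[of _ _ v])
  qed (use P in \<open>auto simp: inner_commute\<close>)
  then have F: "F = {q \<in> ?P. q \<bullet> x = v \<bullet> x}" by (auto simp: F_def face_dir_def)
  have "is_face F ?P" using \<open>x \<noteq> 0\<close> unfolding is_face_def F_def by (intro exI[of _ "- x"]) simp
  moreover have "F \<noteq> ?P"
  proof
    assume "F = ?P"
    then have "?P \<subseteq> {q. x \<bullet> q = v \<bullet> x}" using F by (auto simp: inner_commute)
    then have "interior ?P \<subseteq> interior {q. x \<bullet> q = v \<bullet> x}" by (rule interior_mono)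
    then show False using int \<open>x \<noteq> 0\<close> by simp
  qed
  ultimately have touch: "aff_dim F > 0 \<Longrightarrow> F \<inter> S i \<noteq> {}" for i using faces by blast
  show ?thesis
  proof (cases "aff_dim F > 0")
    case True
    have "\<exists>u\<in>S i. \<forall>s\<in>?A. s \<bullet> x \<le> u \<bullet> x" for i
    proof -
      obtain u where "u \<in> F" "u \<in> S i" using touch[OF True, of i] by blast
      then have "\<forall>s\<in>?A. s \<bullet> x \<le> u \<bullet> x" using v(2) F by auto
      then show ?thesis using \<open>u \<in> S i\<close> by blast
    qed
    then show ?thesis by blast
  next
    case False
    have vF: "v \<in> F" using vP F by simp
    then have "aff_dim F \<ge> 0" by (metis aff_dim_negative_iff empty_iff not_less)
    then have "F = {v}" using False vF aff_dim_eq_0[of F] by force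
    have "s \<bullet> x < v \<bullet> x" if "s \<in> ?A" "s \<noteq> v" for s
    proof -
      have "s \<in> ?P" using that(1) by (rule hull_inc)
      then have "s \<bullet> x \<noteq> v \<bullet> x" using F \<open>F = {v}\<close> that(2) by blast
      then show ?thesis using v(2)[OF that(1)] by simp
    qed
    then show ?thesis using v(1) by blast
  qed
qed

section \<open>Letting the extra weights tend to zero\<close>

text \<open>For \<open>t > 0\<close> every point has positive weight, while at \<open>t = 0\<close>
  only the points of \<open>S i\<close> remain.\<close>

definition degenerating_weights :: "real \<Rightarrow> ('n \<Rightarrow> 'a set) \<Rightarrow> 'n \<Rightarrow> 'a \<Rightarrow> real" where
  "degenerating_weights t S i s = (if s \<in> S i then 1 else t)"

context
  fixes S :: "'n::finite \<Rightarrow> (real^'m::finite) set" and A :: "(real^'m) set"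
  assumes fin: "finite A" and S: "\<And>i. S i \<noteq> {}" "\<And>i. S i \<subseteq> A"
begin

lemma weight_system_degenerating: "0 \<le> t \<Longrightarrow> weight_system A (degenerating_weights t S i)"
  using fin S[of i] by (force simp: weight_system_def degenerating_weights_def)

lemma tendsto_gibbs_degenerating:
  assumes "s \<in> A" "t \<longlonglongrightarrow> 0"
  shows "(\<lambda>m. gibbs A (degenerating_weights (t m) S i) x s)
    \<longlonglongrightarrow> gibbs A (degenerating_weights 0 S i) x s"
proof -
  have w: "(\<lambda>m. degenerating_weights (t m) S i s) \<longlonglongrightarrow> degenerating_weights 0 S i s" for s
    using assms(2) by (simp add: degenerating_weights_def)
  show ?thesis
    unfolding gibbs_def expsum_def
    using expsum_pos[OF weight_system_degenerating[of 0 i], of x]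
    by (intro tendsto_intros w) (simp add: expsum_def)
qed

lemma tendsto_integral_mixed_term:
  assumes dich: "\<And>x. x \<noteq> 0 \<Longrightarrow> (\<forall>i. \<exists>u\<in>S i. \<forall>s\<in>A. s \<bullet> x \<le> u \<bullet> x) \<or>
      (\<exists>v\<in>\<Union>(range S). \<forall>s\<in>A. s \<noteq> v \<longrightarrow> s \<bullet> x < v \<bullet> x)"
    and F: "F \<in> (UNIV :: 'm set) \<rightarrow>\<^sub>E UNIV \<times> A \<times> A" and bij: "bij (\<lambda>k. fst (F k))"
    and t: "\<And>m. 0 < t m" "\<And>m. t m \<le> 1" "t \<longlonglongrightarrow> 0"
  shows "(\<lambda>m. integral UNIV (mixed_term A (degenerating_weights (t m) S) F))
    \<longlonglongrightarrow> integral UNIV (mixed_term A (degenerating_weights 0 S) F)"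
proof (cases "det (\<chi> k. case F k of (i, a, b) \<Rightarrow> a - b) = 0")
  case True
  then have "mixed_term A c F = (\<lambda>_. 0)" for c :: "'n \<Rightarrow> real^'m \<Rightarrow> real" by (simp add: fun_eq_iff mixed_term_def)
  then show ?thesis by simp
next
  case False
  have mem: "a \<in> A \<and> b \<in> A" if "F k = (i, a, b)" for k i a b
    using PiE_mem[OF F, of k] that by auto
  have ray: "\<exists>k i a b s u. F k = (i, a, b) \<and> s \<in> {a, b} \<and> u \<in> S i \<and> 0 < (u - s) \<bullet> x" if x: "x \<noteq> 0" for x
    using dich[OF x]
  proof
    assume max: "\<forall>i. \<exists>u\<in>S i. \<forall>s\<in>A. s \<bullet> x \<le> u \<bullet> x"
    obtain k where k: "(case F k of (i, a, b) \<Rightarrow> a - b) \<bullet> x \<noteq> 0"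
      using ex_nonorthogonal_if_det_nz[OF False x] .
    obtain i a b where Fk: "F k = (i, a, b)" by (metis prod_cases3)
    obtain u where u: "u \<in> S i" "a \<bullet> x \<le> u \<bullet> x" "b \<bullet> x \<le> u \<bullet> x" using max mem[OF Fk] by blast
    have "a \<bullet> x \<noteq> b \<bullet> x" using k Fk by (simp add: inner_diff_left)
    then have "0 < (u - a) \<bullet> x \<or> 0 < (u - b) \<bullet> x" using u by (auto simp: inner_diff_left)
    then show ?thesis using Fk u(1) by blast
  next
    assume "\<exists>v\<in>\<Union>(range S). \<forall>s\<in>A. s \<noteq> v \<longrightarrow> s \<bullet> x < v \<bullet> x"
    then obtain v j where v: "v \<in> S j" "\<And>s. s \<in> A \<Longrightarrow> s \<noteq> v \<Longrightarrow> s \<bullet> x < v \<bullet> x" by blast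
    \<comment> \<open>Bijectivity supplies a row whose pair belongs to the very index
      \<open>j\<close> with \<open>v \<in> S j\<close>.\<close>
    obtain k where k: "fst (F k) = j" using bij by (metis bij_pointE)
    obtain a b where Fk: "F k = (j, a, b)" using k by (metis prod.collapse)
    have "a \<noteq> b"
    proof
      \<comment> \<open>With \<open>a = b\<close> the matrix of differences would have a zero row.
        As \<open>a\<close> and \<open>b\<close> differ, one of them is not
        \<open>v\<close>.\<close>
      assume "a = b"
      then have "row k (\<chi> k. case F k of (i, a, b) \<Rightarrow> a - b) = 0" by (simp add: row_def Fk vec_eq_iff)
      then show False using False det_zero_row(1) by blast
    qed
    then have "0 < (v - a) \<bullet> x \<or> 0 < (v - b) \<bullet> x"
      using v(2) mem[OF Fk] by (auto simp: inner_diff_left)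
    then show ?thesis using Fk v(1) by blast
  qed
  \<comment> \<open>The constant 1 suffices: weights are at most 1 for \<open>t \<le> 1\<close> and
    equal 1 on \<open>S i\<close>. Hence \<open>h\<close> dominates the terms for all
    \<open>t m\<close> at once.\<close>
  obtain h :: "real^'m \<Rightarrow> real" where h: "h integrable_on UNIV"
    "\<And>c x. \<lbrakk>\<And>i. weight_system A (c i); \<And>i s u. \<lbrakk>s \<in> A; u \<in> S i\<rbrakk> \<Longrightarrow> c i s \<le> 1 * c i u \<and> c i u > 0\<rbrakk>
       \<Longrightarrow> \<bar>mixed_term A c F x\<bar> \<le> h x"
    using mixed_term_dominator[OF fin F S(2) zero_le_one ray] by blast
  show ?thesis
  proof (rule dominated_convergence(2)[OF _ h(1)])
    show "mixed_term A (degenerating_weights (t m) S) F integrable_on UNIV" for m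
      using t(1)[of m] by (intro integrable_mixed_term weight_system_degenerating F) simp
    show "norm (mixed_term A (degenerating_weights (t m) S) F x) \<le> h x" for m x
      using t(1)[of m] t(2)[of m]
      by (auto intro!: h(2) weight_system_degenerating simp: degenerating_weights_def)
    show "(\<lambda>m. mixed_term A (degenerating_weights (t m) S) F x)
      \<longlonglongrightarrow> mixed_term A (degenerating_weights 0 S) F x" for x
    proof -
      have "(\<lambda>m. case F k of (i, a, b) \<Rightarrow> gibbs A (degenerating_weights (t m) S i) x a *
            gibbs A (degenerating_weights (t m) S i) x b * a $ k)
        \<longlonglongrightarrow> (case F k of (i, a, b) \<Rightarrow> gibbs A (degenerating_weights 0 S i) x a *
            gibbs A (degenerating_weights 0 S i) x b * a $ k)" for k
        using mem[of k] by (auto split: prod.split intro!: tendsto_intros tendsto_gibbs_degenerating t(3))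
      then show ?thesis unfolding mixed_term_def by (intro tendsto_intros)
    qed
  qed
qed

end

section \<open>Comparing the mixed volumes at positive weights and in the limit\<close>

theorem theorem1:
  fixes S :: "'n::finite \<Rightarrow> (real^'n) set"
  assumes fin: "\<And>i. finite (S i)"
    and rat: "\<And>i x j. x \<in> S i \<Longrightarrow> x $ j \<in> \<rat>"
    and faces: "\<And>F i. is_face F (convex hull (\<Union>k. S k)) \<Longrightarrow>
                  F \<noteq> convex hull (\<Union>k. S k) \<Longrightarrow> aff_dim F > 0 \<Longrightarrow> F \<inter> S i \<noteq> {}"
  shows "mixed_volume (\<lambda>i. convex hull (S i))
           = fact CARD('n) * vol (convex hull (\<Union>k. S k))"
proof (cases "interior (convex hull (\<Union>k. S k)) = {}")
  case True
  let ?P = "convex hull (\<Union>k. S k)"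
  \<comment> \<open>A hull without interior lies in a hyperplane, and so does the Minkowski
    combination; both sides are then 0. If some \<open>S i\<close> is empty, the combination is
    empty and the inclusion is trivial.\<close>
  obtain a b where ab: "a \<noteq> 0" "?P \<subseteq> {x. a \<bullet> x = b}"
    using empty_interior_subset_hyperplane[OF convex_convex_hull True] .
  have "vol ?P = 0"
    using True by (intro negligible_imp_measure0) (simp add: negligible_convex_interior)
  moreover have "mixed_volume (\<lambda>i. convex hull (S i)) = 0"
  proof (rule mixed_volume_eq_0I, rule negligible_imp_measure0)
    fix lam :: "'n \<Rightarrow> real"
    have "minkowski_comb lam (\<lambda>i. convex hull (S i)) \<subseteq> {z. a \<bullet> z = (\<Sum>i\<in>UNIV. lam i * b)}"
    proof
      fix z assume "z \<in> minkowski_comb lam (\<lambda>i. convex hull (S i))"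
      then obtain q where q: "\<And>i. q i \<in> convex hull (S i)" "z = (\<Sum>i\<in>UNIV. lam i *\<^sub>R q i)"
        using minkowski_combE by blast
      have "q i \<in> ?P" for i
        using q(1)[of i] hull_mono[of "S i" "\<Union>k. S k" convex] by blast
      then have "a \<bullet> q i = b" for i using ab(2) by blast
      then show "z \<in> {z. a \<bullet> z = (\<Sum>i\<in>UNIV. lam i * b)}" by (simp add: q(2) inner_sum_right)
    qed
    then show "negligible (minkowski_comb lam (\<lambda>i. convex hull (S i)))"
      using negligible_hyperplane[of a] ab(1) negligible_subset by blast
  qed
  ultimately show ?thesis by simp
next
  case int: False
  have "CARD('n ord_index) = CARD('n)" by (rule card_ord_index)
  \<comment> \<open>Only the coordinates are renumbered; the family \<open>S\<close> keeps its index
    type.\<close>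
  then obtain \<sigma> :: "'n ord_index \<Rightarrow> 'n" where \<sigma>: "bij \<sigma>"
    using finite_same_card_bij[of "UNIV :: 'n ord_index set" "UNIV :: 'n set"] by auto
  define R where "R = reindex \<sigma>"
  have lin: "linear R" unfolding R_def by (rule linear_reindex[OF \<sigma>])
  define S' where "S' = (\<lambda>i. R ` S i)"
  define A where "A = (\<Union>k. S' k)"
  have A: "finite A" using fin by (auto simp: A_def S'_def)
  have S'ne: "S' i \<noteq> {}" for i
    using nonempty_if_meets_proper_faces[OF fin faces int] by (simp add: S'_def)
  have S'A: "S' i \<subseteq> A" for i by (auto simp: A_def)
  have AR: "A = R ` (\<Union>k. S k)" by (auto simp: A_def S'_def)
  have dich: "(\<forall>i. \<exists>u\<in>S' i. \<forall>s\<in>A. s \<bullet> y \<le> u \<bullet> y) \<or>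
      (\<exists>v\<in>\<Union>(range S'). \<forall>s\<in>A. s \<noteq> v \<longrightarrow> s \<bullet> y < v \<bullet> y)" if "y \<noteq> 0" for y
  proof -
    obtain x where x: "y = R x" using bij_reindex[OF \<sigma>] unfolding R_def by (metis bij_pointE)
    have "x \<noteq> 0" using \<open>y \<noteq> 0\<close> linear_0[OF lin] x by auto
    have inn: "R p \<bullet> y = p \<bullet> x" for p unfolding x R_def by (rule inner_reindex[OF \<sigma>])
    from maximiser_dichotomy[OF fin faces int \<open>x \<noteq> 0\<close>] show ?thesis
    proof
      assume "\<forall>i. \<exists>u\<in>S i. \<forall>s\<in>(\<Union>k. S k). s \<bullet> x \<le> u \<bullet> x"
      then show ?thesis by (intro disjI1) (auto simp: AR S'_def inn)
    next
      assume "\<exists>v\<in>(\<Union>k. S k). \<forall>s\<in>(\<Union>k. S k). s \<noteq> v \<longrightarrow> s \<bullet> x < v \<bullet> x"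
      then obtain v where v: "v \<in> (\<Union>k. S k)" "\<forall>s\<in>(\<Union>k. S k). s \<noteq> v \<longrightarrow> s \<bullet> x < v \<bullet> x" ..
      have "R v \<in> \<Union>(range S')" using v(1) by (auto simp: S'_def)
      moreover have "\<forall>s\<in>A. s \<noteq> R v \<longrightarrow> s \<bullet> y < R v \<bullet> y"
        using v(2) by (auto simp: AR inn)
      ultimately show ?thesis by blast
    qed
  qed
  define \<Phi> where "\<Phi> = ((UNIV :: 'n ord_index set) \<rightarrow>\<^sub>E (UNIV :: 'n set) \<times> A \<times> A)"
  have \<Phi>: "finite \<Phi>" unfolding \<Phi>_def using A by (intro finite_PiE) auto
  define I where "I = (\<lambda>t F. integral UNIV (mixed_term A (degenerating_weights t S') F))"
  have ws: "weight_system A (degenerating_weights t S' i)" if "t \<ge> 0" for t i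
    using weight_system_degenerating[OF A S'ne S'A that] .
  \<comment> \<open>Stated for \<open>t \<ge> 0\<close> and general \<open>Q\<close>, so that it
    covers both the constant family (\<open>t > 0\<close>) and the given hulls
    (\<open>t = 0\<close>).\<close>
  have MV: "mixed_volume Q = (\<Sum>F\<in>{F\<in>\<Phi>. bij (\<lambda>k. fst (F k))}. I t F)"
    if "t \<ge> 0" and Q: "\<And>i. convex (Q i)" "\<And>i. R ` Q i = convex hull {s \<in> A. degenerating_weights t S' i s > 0}"
    for t Q
  proof (rule mixed_volume_eqI[OF \<Phi>])
    fix lam :: "'n \<Rightarrow> real" assume lam: "\<And>i. lam i > 0"
    have "vol (minkowski_comb lam Q) = vol (R ` minkowski_comb lam Q)"
      unfolding R_def by (rule vol_reindex_convex[OF \<sigma> convex_minkowski_comb, symmetric]) (rule Q)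
    also have "R ` minkowski_comb lam Q = minkowski_comb lam (\<lambda>i. convex hull {s \<in> A. degenerating_weights t S' i s > 0})"
      using reindex_minkowski_comb[OF \<sigma>, of lam Q] Q(2) by (simp add: R_def)
    finally show "vol (minkowski_comb lam Q) = (\<Sum>F\<in>\<Phi>. I t F * (\<Prod>k\<in>UNIV. lam (fst (F k))))"
      using vol_minkowski_comb_eq_mixed_terms[where c = "degenerating_weights t S'" and lam = lam, OF ws lam] \<open>t \<ge> 0\<close>
      by (simp add: \<Phi>_def I_def)
  qed
  let ?P = "convex hull (\<Union>k. S k)"
  have hullR: "R ` (convex hull X) = convex hull (R ` X)" for X
    using convex_hull_linear_image[OF lin] by simp
  \<comment> \<open>For positive \<open>t\<close> every support is all of \<open>A\<close>, so the
    sum has the same value for all such \<open>t\<close>, although its individual integrals may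
    vary.\<close>
  have pos: "(\<Sum>F\<in>{F\<in>\<Phi>. bij (\<lambda>k. fst (F k))}. I t F) = fact CARD('n) * vol ?P" if "t > 0" for t
  proof -
    have "{s \<in> A. degenerating_weights t S' i s > 0} = A" for i
      using that by (auto simp: degenerating_weights_def)
    then have "mixed_volume (\<lambda>_. ?P) = (\<Sum>F\<in>{F\<in>\<Phi>. bij (\<lambda>k. fst (F k))}. I t F)"
      using that by (intro MV) (simp_all add: hullR AR)
    then show ?thesis by (simp add: mixed_volume_const)
  qed
  have zero: "mixed_volume (\<lambda>i. convex hull (S i)) = (\<Sum>F\<in>{F\<in>\<Phi>. bij (\<lambda>k. fst (F k))}. I 0 F)"
  proof (rule MV)
    fix i
    have "{s \<in> A. degenerating_weights 0 S' i s > 0} = S' i"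
      using S'A by (auto simp: degenerating_weights_def)
    then show "R ` (convex hull (S i)) = convex hull {s \<in> A. degenerating_weights 0 S' i s > 0}"
      by (simp add: hullR S'_def)
  qed auto
  define t where "t = (\<lambda>m. inverse (real (Suc m)))"
  have t: "\<And>m. 0 < t m" "\<And>m. t m \<le> 1" "t \<longlonglongrightarrow> 0"
    unfolding t_def using LIMSEQ_inverse_real_of_nat by (auto simp: field_simps)
  have "(\<lambda>m. \<Sum>F\<in>{F\<in>\<Phi>. bij (\<lambda>k. fst (F k))}. I (t m) F) \<longlonglongrightarrow> (\<Sum>F\<in>{F\<in>\<Phi>. bij (\<lambda>k. fst (F k))}. I 0 F)"
    unfolding I_def using t
    by (intro tendsto_sum tendsto_integral_mixed_term[OF A S'ne S'A dich]) (auto simp: \<Phi>_def)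
  \<comment> \<open>The convergent sequence is constant, so its limit at weight 0 is that
    constant.\<close>
  then have "(\<Sum>F\<in>{F\<in>\<Phi>. bij (\<lambda>k. fst (F k))}. I 0 F) = fact CARD('n) * vol ?P"
    using pos[OF t(1)] by (simp add: LIMSEQ_const_iff)
  then show ?thesis using zero by simp
qed

end
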